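(* Let $n\ge2$ be an integer with prime factorization $n=\prod_{j=1}^Kp_j^{n_j}$ ($p_j$ distinct primes, $n_j\ge1$), let $\tilde n=\prod_{j=1}^Kp_j$ and $Z_{\tilde n}=(n/\tilde n)Z_n\subset Z_n$. Let $E$ be a full set of representatives of the cosets in $Z_n/Z_{\tilde n}$, so that $Z_n=Z_{\tilde n}+E$. Then the following hold, both when "(quasi-)independent" is read throughout as "independent" and when it is read throughout as "quasi-independent". (1) Let $1\le a\le K$. Let $\sigma'$ be any permutation of $Z_{p_a^{n_a}}$ that maps each coset of $Z_{p_a}$ into another (or the same) coset of $Z_{p_a}$. Let $\sigma$ be the permutation of $Z_n$ that is the product of $\sigma'$ with the identity permutations on the other $K-1$ factors of $Z_n=\prod_{j=1}^KZ_{p_j^{n_j}}$. Then $\sigma$ preserves (quasi-)independent sets. (2) Suppose $p_1=2$. Let $\sigma$ be any permutation of $Z_n$ that maps each coset of $Z_2$ into itself. Then $\sigma$ preserves (quasi-)independent sets. (3) Let $\sigma'$ be any permutation of $E$. Define a permutation $\sigma$ of $Z_n$ by $\sigma(x+y)=x+\sigma'(y)$ for $x\in Z_{\tilde n}$, $y\in E$. Then $\sigma$ preserves (quasi-)independent sets. (4) Let $\sigma$ be any permutation of $Z_{\tilde n}$. Extend $\sigma$ to all of $Z_n$ by letting $\sigma$ be the identity on $Z_n\setminus Z_{\tilde n}$. Then the extended $\sigma$ preserves the (quasi-)independent subsets of $Z_n$ if and only if $\sigma$ preserves the (quasi-)independent subsets of $Z_{\tilde n}$. (5) Any product (composition) of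 permutations of $Z_n$ that preserve the (quasi-)independent sets preserves the (quasi-)independent sets. (6) Let $\sigma$ be any group automorphism of $Z_n$ or a translation of $Z_n$. Then $\sigma$ preserves (quasi-)independent sets. (7) Every permutation $\sigma$ of $Z_n$ that preserves (quasi-)independent sets is a product (composition) of permutations each of which is of one of the types described in (1), (2), (3), or of the type described in (4) with the permutation of $Z_{\tilde n}$ preserving the (quasi-)independent subsets of $Z_{\tilde n}$.
   Context: A subset $B$ of an additive abelian group is quasi-independent if, whenever $k\ge1$, $x_1,\dots,x_k\in B$ are distinct, $\epsilon_j\in\{0,1,-1\}$ and $\sum_j\epsilon_jx_j=0$, then all $\epsilon_j=0$. It is independent if, whenever $k\ge1$, $x_1,\dots,x_k\in B$ are distinct, $\epsilon_j\in\mathbb{Z}$ and $\sum_j\epsilon_jx_j=0$, then $\epsilon_jx_j=0$ for all $j$. Let $T_n\subset\mathbb{C}$ be the set of $n$-th roots of unity. The multiplicative group $T_n$ is identified with the additive cyclic group $Z_n$ of order $n$ (via $k\mapsto e^{2\pi ik/n}$), and $Z_n$ is identified with the direct product of its subgroups $Z_{p_j^{n_j}}$ of order $p_j^{n_j}$. For each $d\mid n$, $Z_d$ denotes the subgroup of order $d$ of $Z_n$; in particular $Z_{p_a}$ is the subgroup of order $p_a$, i.e. $p_a^{n_a-1}Z_{p_a^{n_a}}$. A subset of $Z_n$ is called quasi-independent or independent if the corresponding subset of $T_n$ is so as a subset of the additive group $\mathbb{C}$ (not of the group $Z_n$). A permutation $\sigma$ of a set $X\subset Z_n$ preserves the (quasi-)independent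 sets if, for every $F\subset X$, $F$ is (quasi-)independent if and only if $\sigma(F)$ is. *)

theory Defs
  imports
    "HOL-Algebra.Elementary_Groups"
    "HOL-Algebra.FiniteProduct"
    "HOL-Combinatorics.Permutations"
    "HOL-Computational_Algebra.Primes"
    Complex_Main
begin

definition zscale :: "int \<Rightarrow> 'a::ab_group_add \<Rightarrow> 'a" where
  "zscale k x = (\<Sum>i<nat k. x) - (\<Sum>i<nat (- k). x)"

lemma zscale_eq_of_int_mult: "zscale k x = of_int k * x" for x :: "'a::ring_1"
  by (cases "k \<ge> 0") (simp_all add: zscale_def)

definition group_quasi_independent :: "'a::ab_group_add set \<Rightarrow> bool" where
  "group_quasi_independent B \<longleftrightarrow>
     (\<forall>F \<epsilon>. finite F \<and> F \<subseteq> B \<and> (\<forall>x\<in>F. \<epsilon> x \<in> {0, 1, -1}) \<and> (\<Sum>x\<in>F. zscale (\<epsilon> x) x) = 0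
        \<longrightarrow> (\<forall>x\<in>F. \<epsilon> x = 0))"

definition group_independent :: "'a::ab_group_add set \<Rightarrow> bool" where
  "group_independent B \<longleftrightarrow>
     (\<forall>F \<epsilon>. finite F \<and> F \<subseteq> B \<and> (\<Sum>x\<in>F. zscale (\<epsilon> x) x) = 0
        \<longrightarrow> (\<forall>x\<in>F. zscale (\<epsilon> x) x = 0))"

abbreviation Z :: "nat \<Rightarrow> int monoid" where
  "Z \<equiv> integer_mod_group"

text \<open>For \<open>d dvd n\<close>, the subgroup \<open>(n / d) Z n\<close> of order \<open>d\<close>; the multiple \<open>(n / d) x\<close> is a
  power because the (additive) group \<^term>\<open>Z n\<close> is a \<^typ>\<open>int monoid\<close> record.\<close>

definition Zsub :: "nat \<Rightarrow> nat \<Rightarrow> int set" where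
  "Zsub n d = (\<lambda>x. x [^]\<^bsub>Z n\<^esub> (n div d)) ` carrier (Z n)"

lemma Zsub_eq:
  assumes "n > 0" "d dvd n"
  shows "Zsub n d = (\<lambda>k. int (n div d) * k) ` {0..<int d}"
proof -
  obtain m where n: "n = m * d" using assms(2) by (metis dvd_def mult.commute)
  have md: "m > 0" "d > 0" using assms n by auto
  have m: "n div d = m" using n md by simp
  have *: "(int m * x) mod int n = int m * (x mod int d)" for x
    unfolding n of_nat_mult by (rule mult_mod_right [symmetric])
  have "Zsub n d = (\<lambda>x. int m * (x mod int d)) ` {0..<int n}"
    using assms(1) by (simp add: Zsub_def m * carrier_integer_mod_group)
  also have "\<dots> = (\<lambda>k. int m * k) ` {0..<int d}"
  proof (intro subset_antisym subsetI)
    fix y assume "y \<in> (\<lambda>x. int m * (x mod int d)) ` {0..<int n}"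
    then show "y \<in> (\<lambda>k. int m * k) ` {0..<int d}" using md by auto
  next
    fix y assume "y \<in> (\<lambda>k. int m * k) ` {0..<int d}"
    then obtain k where k: "y = int m * k" "0 \<le> k" "k < int d" by fastforce
    have "d \<le> n" using assms by (simp add: dvd_imp_le)
    then have "k \<in> {0..<int n}" "y = int m * (k mod int d)" using k by auto
    then show "y \<in> (\<lambda>x. int m * (x mod int d)) ` {0..<int n}" by blast
  qed
  finally show ?thesis by (simp add: m)
qed

lemma card_Zsub:
  assumes "n > 0" "d dvd n"
  shows "card (Zsub n d) = d"
proof -
  have "n div d > 0" using assms by (metis dvd_div_eq_0_iff gr0I)
  then have "inj_on (\<lambda>k. int (n div d) * k) {0..<int d}" by (auto simp: inj_on_def)
  then show ?thesis by (simp add: Zsub_eq[OF assms] card_image)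
qed

lemma subgroup_Zsub: "subgroup (Zsub n d) (Z n)"
proof -
  interpret comm_group "Z n" by simp
  have "(\<lambda>x. x [^]\<^bsub>Z n\<^esub> (n div d)) \<in> hom (Z n) (Z n)"
    unfolding hom_def using nat_pow_closed nat_pow_distrib by blast
  then interpret group_hom "Z n" "Z n" "\<lambda>x. x [^]\<^bsub>Z n\<^esub> (n div d)"
    by (simp only: group_hom_def group_hom_axioms_def group_integer_mod_group simp_thms)
  show ?thesis unfolding Zsub_def by (rule img_is_subgroup)
qed

definition rad :: "nat \<Rightarrow> nat" where
  "rad n = \<Prod>(prime_factors n)"

definition coset_reps :: "nat \<Rightarrow> int set \<Rightarrow> bool" where
  "coset_reps n E \<longleftrightarrow>
     E \<subseteq> carrier (Z n) \<and> (\<forall>C \<in> rcosets\<^bsub>Z n\<^esub> Zsub n (rad n). \<exists>!y. y \<in> E \<inter> C)"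

definition unity_root :: "nat \<Rightarrow> int \<Rightarrow> complex" where
  "unity_root n k = cis (2 * pi * of_int k / of_nat n)"

definition preserves :: "nat \<Rightarrow> (complex set \<Rightarrow> bool) \<Rightarrow> int set \<Rightarrow> (int \<Rightarrow> int) \<Rightarrow> bool" where
  "preserves n indep X \<sigma> \<longleftrightarrow>
     bij_betw \<sigma> X X \<and>
     (\<forall>F \<subseteq> X. indep (unity_root n ` F) \<longleftrightarrow> indep (unity_root n ` \<sigma> ` F))"

text \<open>The group \<^term>\<open>Z n\<close> is the internal direct product of its subgroups
  \<open>Zsub n (q ^ multiplicity q n)\<close>, so each of its elements is \<open>\<Otimes>\<^bsub>Z n\<^esub>q\<in>prime_factors n. x q\<close> for
  a unique family of components \<open>x q\<close>; \<open>\<sigma>'\<close> acts on the component at \<open>p\<close> only.\<close>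

definition primary_component_perm :: "nat \<Rightarrow> nat \<Rightarrow> (int \<Rightarrow> int) \<Rightarrow> bool" where
  "primary_component_perm n p \<sigma> \<longleftrightarrow>
     \<sigma> permutes carrier (Z n) \<and>
     (\<exists>\<sigma>'. \<sigma>' permutes Zsub n (p ^ multiplicity p n) \<and>
        (\<forall>x \<in> Zsub n (p ^ multiplicity p n). \<exists>y \<in> Zsub n (p ^ multiplicity p n).
           \<sigma>' ` (Zsub n p #>\<^bsub>Z n\<^esub> x) \<subseteq> Zsub n p #>\<^bsub>Z n\<^esub> y) \<and>
        (\<forall>x \<in> (\<Pi> q\<in>prime_factors n. Zsub n (q ^ multiplicity q n)).
           \<sigma> (\<Otimes>\<^bsub>Z n\<^esub>q\<in>prime_factors n. x q) =
             (\<Otimes>\<^bsub>Z n\<^esub>q\<in>prime_factors n. if q = p then \<sigma>' (x q) else x q)))"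

definition Z2_coset_perm :: "nat \<Rightarrow> (int \<Rightarrow> int) \<Rightarrow> bool" where
  "Z2_coset_perm n \<sigma> \<longleftrightarrow>
     \<sigma> permutes carrier (Z n) \<and>
     (\<forall>x \<in> carrier (Z n). \<sigma> ` (Zsub n 2 #>\<^bsub>Z n\<^esub> x) \<subseteq> Zsub n 2 #>\<^bsub>Z n\<^esub> x)"

definition reps_perm :: "nat \<Rightarrow> int set \<Rightarrow> (int \<Rightarrow> int) \<Rightarrow> bool" where
  "reps_perm n E \<sigma> \<longleftrightarrow>
     \<sigma> permutes carrier (Z n) \<and>
     (\<exists>\<sigma>'. \<sigma>' permutes E \<and>
        (\<forall>x \<in> Zsub n (rad n). \<forall>y \<in> E. \<sigma> (x \<otimes>\<^bsub>Z n\<^esub> y) = x \<otimes>\<^bsub>Z n\<^esub> \<sigma>' y))"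

text \<open>In the last disjunct, and in every use of \<^term>\<open>\<sigma> permutes Zsub n (rad n)\<close>, the extension of
  \<open>\<sigma>\<close> to \<^term>\<open>Z n\<close> by the identity is \<open>\<sigma>\<close> itself, since \<^const>\<open>permutes\<close> requires \<open>\<sigma>\<close> to fix
  all elements outside the given set.\<close>

definition generating_perm :: "nat \<Rightarrow> (complex set \<Rightarrow> bool) \<Rightarrow> int set \<Rightarrow> (int \<Rightarrow> int) \<Rightarrow> bool" where
  "generating_perm n indep E \<sigma> \<longleftrightarrow>
     (\<exists>p \<in> prime_factors n. primary_component_perm n p \<sigma>) \<or>
     2 \<in> prime_factors n \<and> Z2_coset_perm n \<sigma> \<or>
     reps_perm n E \<sigma> \<or>
     \<sigma> permutes Zsub n (rad n) \<and> preserves n indep (Zsub n (rad n)) \<sigma>"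

end

theory Submission
  imports Defs "HOL-Computational_Algebra.Polynomial" "HOL-Number_Theory.Cong"
begin

text \<open>
  Write \<open>\<omega> = e\<^bsup>2\<pi>i/n\<^esup>\<close>. Dependence and quasi-dependence of a set of \<open>n\<close>-th roots of unity both say
  that some nonzero \<open>f : Z\<^sub>n \<rightarrow> \<int>\<close>, supported on the corresponding set of exponents and with values in a
  symmetric set \<open>A\<close> (all of \<open>\<int>\<close>, or \<open>{0, 1, -1}\<close>), is a relation: \<open>\<Sum>\<^sub>x f x \<omega>\<^sup>x = 0\<close>. Everything therefore
  rests on one description of the relations, \<open>vanishing_decomposition\<close> and its converse
  \<open>vanishing_periodic\<close>: \<open>f\<close> is a relation if and only if \<open>f = \<Sum>\<^sub>q h\<^sub>q\<close>, where \<open>q\<close> runs over the primes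
  dividing \<open>n\<close> and \<open>h\<^sub>q\<close> is a complex function that is constant on the cosets of \<open>Z\<^sub>q\<close>.

  The nontrivial half of this description has two ingredients. If an integer polynomial vanishes at
  \<open>\<omega>\<close>, then it vanishes at \<open>\<omega>\<^sup>u\<close> for every \<open>u\<close> coprime to \<open>n\<close> (\<open>root_of_unity_coprime_conjugate\<close>); so
  the Fourier transform of a relation is supported on the \<open>u\<close> that share a prime \<open>q\<close> with \<open>n\<close>, and the
  character belonging to such a \<open>u\<close> is constant on the cosets of \<open>Z\<^sub>q\<close>.

  The description is invariant under every permutation that maps, for each \<open>q\<close>, cosets of \<open>Z\<^sub>q\<close> to cosets
  of \<open>Z\<^sub>q\<close> (\<open>free_preserving_if_respects\<close>). The product permutations acting on one primary component,
  the permutations of \<open>E\<close>, the automorphisms and the translations are all of this kind. The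
  permutations within the cosets of \<open>Z\<^sub>2\<close> multiply each root of unity by a sign and so change at most
  the signs of the coefficients.

  The description also shows that a relation may be cut along the cosets of \<open>Z\<^bsub>rad n\<^esub>\<close>, since each
  \<open>h\<^sub>q\<close> may (\<open>vanishing_restrict_class\<close>). Hence a set is (quasi-)independent as soon as its intersection
  with each of these cosets is, which settles the extension of permutations of \<open>Z\<^bsub>rad n\<^esub>\<close> by the
  identity.

  For the decomposition of an arbitrary preserving permutation \<open>\<sigma>\<close>, observe that the cosets of \<open>Z\<^sub>q\<close> are
  minimal dependent sets, and that a minimal dependent set lies in one coset of \<open>Z\<^bsub>rad n\<^esub>\<close> because
  relations can be cut. So \<open>\<sigma>\<close> maps cosets of \<open>Z\<^sub>q\<close> into cosets of \<open>Z\<^bsub>rad n\<^esub>\<close>, and as the \<open>Z\<^sub>q\<close> together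
  generate \<open>Z\<^bsub>rad n\<^esub>\<close>, it permutes the cosets of \<open>Z\<^bsub>rad n\<^esub>\<close> (\<open>preserving_cong\<close>). Undoing this by a
  permutation of \<open>E\<close> leaves a permutation that acts on each coset separately; conjugating its action
  on one coset by the permutation of \<open>E\<close> that exchanges this coset with \<open>Z\<^bsub>rad n\<^esub>\<close> gives a preserving
  permutation of \<open>Z\<^bsub>rad n\<^esub>\<close> (\<open>generated_preserving\<close>).
\<close>

section \<open>Integer polynomials vanishing at a root of unity\<close>

abbreviation ipoly :: "int poly \<Rightarrow> complex \<Rightarrow> complex" where
  "ipoly f z \<equiv> poly (map_poly of_int f) z"

lemma ipoly_pCons [simp]: "ipoly (pCons a f) z = of_int a + z * ipoly f z"
  by (simp add: map_poly_pCons)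

lemma ipoly_add [simp]: "ipoly (f + g) z = ipoly f z + ipoly g z"
  by (induction f g rule: poly_induct2) (simp_all add: algebra_simps)

lemma ipoly_smult [simp]: "ipoly (smult c f) z = of_int c * ipoly f z"
  by (induction f) (simp_all add: algebra_simps)

lemma ipoly_diff [simp]: "ipoly (f - g) z = ipoly f z - ipoly g z"
  using ipoly_add[of "f - g" g z] by (simp del: ipoly_add)

lemma ipoly_minus [simp]: "ipoly (- f) z = - ipoly f z"
  using ipoly_diff[of 0 f z] by (simp del: ipoly_diff)

lemma ipoly_mult [simp]: "ipoly (f * g) z = ipoly f z * ipoly g z"
  by (induction f) (simp_all add: algebra_simps)

lemma ipoly_power [simp]: "ipoly (f ^ k) z = ipoly f z ^ k"
  by (induction k) simp_all

lemma ipoly_of_nat [simp]: "ipoly (of_nat k) z = of_nat k"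
  by (simp add: of_nat_poly)

lemma ipoly_sum [simp]: "ipoly (\<Sum>i\<in>I. f i) z = (\<Sum>i\<in>I. ipoly (f i) z)"
  by (induction I rule: infinite_finite_induct) simp_all

lemma ipoly_monom [simp]: "ipoly (monom c k) z = of_int c * z ^ k"
  by (simp add: map_poly_monom poly_monom)

lemma ipoly_pcompose [simp]: "ipoly (pcompose f g) z = ipoly f (ipoly g z)"
  by (induction f) (simp_all add: pcompose_pCons)

text \<open>The minimal polynomial over \<open>\<int>\<close>, for \<open>z\<close> that need not be integral over \<open>\<int>\<close>: a primitive
  polynomial of least degree divides every other one up to a constant factor, by pseudo-division, and
  the constant can be cancelled by Gauss's lemma.\<close>

lemma integral_minimal_poly:
  assumes "f0 \<noteq> 0" "ipoly f0 z = 0"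
  obtains g where "g \<noteq> 0" "ipoly g z = 0" "\<And>f. ipoly f z = 0 \<Longrightarrow> g dvd f"
    "\<And>f. ipoly f z = 0 \<Longrightarrow> f = 0 \<or> degree g \<le> degree f"
proof -
  define P where "P = (\<lambda>g::int poly. g \<noteq> 0 \<and> ipoly g z = 0)"
  define h where "h = arg_min degree P"
  have "P f0" using assms by (simp add: P_def)
  then have h: "P h" and min: "\<And>f. P f \<Longrightarrow> degree h \<le> degree f"
    unfolding h_def by (auto intro: arg_min_natI arg_min_nat_le)
  define g where "g = primitive_part h"
  have "h = smult (content h) g" by (simp add: g_def)
  then have "ipoly h z = of_int (content h) * ipoly g z" by (metis ipoly_smult)
  with h have g: "g \<noteq> 0" "ipoly g z = 0" "content g = 1"
    by (auto simp: P_def g_def)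
  have ming: "f = 0 \<or> degree g \<le> degree f" if "ipoly f z = 0" for f
    using min[of f] that by (auto simp: P_def g_def)
  have "g dvd f" if f: "ipoly f z = 0" for f
  proof -
    obtain c q where c: "c \<noteq> 0" "smult c f = g * q + pseudo_mod f g"
      using pseudo_mod(1)[OF g(1), of f] by blast
    have "ipoly (pseudo_mod f g) z = ipoly (smult c f - g * q) z"
      using c(2) by (simp del: ipoly_diff)
    then have "ipoly (pseudo_mod f g) z = 0" using f g(2) by simp
    with pseudo_mod(2)[OF g(1), of f] ming[of "pseudo_mod f g"] have "pseudo_mod f g = 0" by auto
    with c have cf: "smult c f = g * q" by simp
    \<comment> \<open>Since \<open>g\<close> is primitive, the factor \<open>c\<close> can be cancelled against \<open>q\<close>.\<close>
    then have "content q = normalize c * content f"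
      using g(3) by (metis content_mult content_smult mult_1)
    then have "c dvd content q" by simp
    then have "[:c:] dvd q" using const_poly_dvd_iff_dvd_content by blast
    then obtain q' where "q = smult c q'" by (auto elim!: dvdE)
    with cf c(1) have "f = g * q'" by (metis mult_smult_right smult_cancel)
    then show ?thesis by simp
  qed
  then show ?thesis using that g ming by blast
qed

lemma binomial_prime_power:
  fixes x y :: "'a::comm_ring_1"
  assumes "prime p"
  shows "\<exists>s. (x + y) ^ p = x ^ p + y ^ p + of_nat p * s"
proof -
  have p: "p > 0" using assms by (simp add: prime_gt_0_nat)
  have "(x + y) ^ p = (\<Sum>k\<le>p. of_nat (p choose k) * x ^ k * y ^ (p - k))"
    by (rule binomial_ring)
  also have "{..p} = insert 0 (insert p {1..<p})" using p by auto
  also have "(\<Sum>k\<in>\<dots>. of_nat (p choose k) * x ^ k * y ^ (p - k))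
      = y ^ p + x ^ p + (\<Sum>k\<in>{1..<p}. of_nat (p choose k) * x ^ k * y ^ (p - k))"
    using p by simp
  also have "(\<Sum>k\<in>{1..<p}. of_nat (p choose k) * x ^ k * y ^ (p - k))
      = (\<Sum>k\<in>{1..<p}. of_nat p * (of_nat ((p choose k) div p) * x ^ k * y ^ (p - k)))"
  proof (rule sum.cong[OF refl])
    fix k assume "k \<in> {1..<p}"
    then have "p dvd (p choose k)" using assms by (intro dvd_choose_prime) auto
    then have "of_nat (p choose k) = (of_nat p * of_nat ((p choose k) div p) :: 'a)"
      by (metis dvd_mult_div_cancel of_nat_mult)
    then show "of_nat (p choose k) * x ^ k * y ^ (p - k)
        = of_nat p * (of_nat ((p choose k) div p) * x ^ k * y ^ (p - k))"
      by (simp add: mult.assoc)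
  qed
  finally show ?thesis by (auto simp: sum_distrib_left[symmetric] add.commute)
qed

lemma fermat_int:
  fixes a :: int
  assumes "prime p"
  shows "\<exists>b. a ^ p = a + of_nat p * b"
proof (induction a rule: int_induct[of _ 0])
  case base
  then show ?case using assms by (auto simp: prime_gt_0_nat intro!: exI[of _ 0])
next
  case (step1 i)
  then obtain b where "i ^ p = i + of_nat p * b" by blast
  moreover obtain s where "(i + 1) ^ p = i ^ p + 1 ^ p + of_nat p * s"
    using binomial_prime_power[OF assms, of i 1] by blast
  ultimately have "(i + 1) ^ p = i + 1 + of_nat p * (b + s)" by (simp add: algebra_simps)
  then show ?case by blast
next
  case (step2 i)
  then obtain b where "i ^ p = i + of_nat p * b" by blast
  moreover obtain s where "i ^ p = (i - 1) ^ p + 1 ^ p + of_nat p * s"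
    using binomial_prime_power[OF assms, of "i - 1" 1] by auto
  ultimately have "(i - 1) ^ p = i - 1 + of_nat p * (b - s)" by (simp add: algebra_simps)
  then show ?case by blast
qed

text \<open>Modulo \<open>p\<close>, the Frobenius endomorphism of \<open>\<int>[X]\<close> is the substitution of \<open>X\<^sup>p\<close> for \<open>X\<close>.\<close>

lemma frobenius_int_poly:
  fixes f :: "int poly"
  assumes "prime p"
  shows "\<exists>r. pcompose f (monom 1 p) = f ^ p + of_nat p * r"
proof (induction f)
  case 0
  then show ?case using assms by (auto simp: prime_gt_0_nat intro!: exI[of _ 0])
next
  case (pCons a f)
  then obtain r where r: "pcompose f (monom 1 p) = f ^ p + of_nat p * r" by blast
  obtain b where b: "a ^ p = a + of_nat p * b" using fermat_int[OF assms] by blast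
  define X :: "int poly" where "X = [:0, 1:]"
  have X: "monom 1 p = X ^ p" by (simp add: monom_altdef X_def)
  obtain s where s: "([:a:] + X * f) ^ p = [:a:] ^ p + (X * f) ^ p + of_nat p * s"
    using binomial_prime_power[OF assms] by blast
  have ap: "[:a:] ^ p = [:a:] + of_nat p * [:b:]"
    by (simp add: poly_const_pow b of_nat_poly)
  have "pCons a f = [:a:] + X * f" by (simp add: X_def)
  then have "(pCons a f) ^ p = [:a:] + of_nat p * [:b:] + X ^ p * f ^ p + of_nat p * s"
    using s by (simp only: ap power_mult_distrib)
  moreover have "pcompose (pCons a f) (monom 1 p) = [:a:] + X ^ p * (f ^ p + of_nat p * r)"
    by (simp add: pcompose_pCons r[unfolded X] X)
  ultimately have "pcompose (pCons a f) (monom 1 p)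
      = (pCons a f) ^ p + of_nat p * (X ^ p * r - [:b:] - s)"
    by (simp add: algebra_simps)
  then show ?case by blast
qed

lemma degree_monom_minus_one: "degree (monom 1 n - 1 :: int poly) = n" if "n > 0"
  using degree_add_eq_left[of "- 1" "monom 1 n :: int poly"] that by (simp add: degree_monom_eq)

text \<open>In other words, \<open>1/p\<close> is not in \<open>\<int>[z]\<close>. The minimal polynomial \<open>g\<close> of \<open>z\<close> divides the monic
  polynomial \<open>X\<^sup>n - 1\<close> and hence has leading coefficient \<open>\<plusminus>1\<close>; so \<open>t\<close> may be reduced to degree less
  than \<open>degree g\<close>, where \<open>p t(z) = 1\<close> becomes an identity between
  polynomials that exhibits \<open>p\<close> as a divisor of \<open>\<plusminus>1\<close>.\<close>

lemma prime_not_unit_at_root_of_unity: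
  assumes n: "n > 0" and z: "z ^ n = 1" and p: "prime p"
  shows "of_nat p * ipoly t z \<noteq> 1"
proof
  assume t: "of_nat p * ipoly t z = 1"
  let ?u = "monom 1 n - 1 :: int poly"
  have lcu: "lead_coeff ?u = 1" 
  proof -
    have "degree ?u = n" using n by (rule degree_monom_minus_one)
    then show ?thesis using n by simp
  qed
  then have u: "?u \<noteq> 0" "ipoly ?u z = 0" using z by (metis coeff_0 zero_neq_one, simp)
  obtain g where g: "g \<noteq> 0" "ipoly g z = 0" "\<And>f. ipoly f z = 0 \<Longrightarrow> g dvd f"
    "\<And>f. ipoly f z = 0 \<Longrightarrow> f = 0 \<or> degree g \<le> degree f"
    using integral_minimal_poly[OF u] by blast
  obtain k where "?u = g * k" using g(3)[OF u(2)] by blast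
  then have lc: "is_unit (lead_coeff g)" using lcu by (metis dvdI lead_coeff_mult)
  have "degree g > 0"
  proof (rule ccontr)
    assume "\<not> degree g > 0"
    then obtain c where "g = [:c:]" by (metis degree_0_id gr0I degree_eq_zeroE)
    then show False using g by simp
  qed
  obtain q r where qr: "pseudo_divmod t g = (q, r)" by fastforce
  define e where "e = lead_coeff g ^ (Suc (degree t) - degree g)"
  have eq: "smult e t = g * q + r" and deg: "r = 0 \<or> degree r < degree g"
    using pseudo_divmod[OF g(1) qr] by (auto simp: e_def)
  have e: "is_unit e" using lc by (simp add: e_def power_abs)
  let ?h = "smult (int p) r - [:e:]"
  have "ipoly (smult e t) z = ipoly (g * q + r) z" by (simp add: eq)
  then have "ipoly ?h z = of_int e * (of_nat p * ipoly t z) - of_int e" using g(2) by simp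
  then have "ipoly ?h z = 0" using t by simp
  moreover have "degree ?h < degree g"
    using deg \<open>degree g > 0\<close> by (intro degree_diff_less) auto
  ultimately have "?h = 0" using g(4) by fastforce
  then have "coeff ?h 0 = 0" by simp
  then have "int p * coeff r 0 = e" by simp
  then have "int p dvd e" by (metis dvd_triv_left)
  then have "is_unit (int p)" using e dvd_trans by blast
  then show False using p by auto
qed

text \<open>Dedekind's argument for the irreducibility of cyclotomic polynomials. Factor \<open>X\<^sup>n - 1 = g k\<close> with
  the minimal polynomial \<open>g\<close> of \<open>z\<close>. If \<open>f(z\<^sup>p) \<noteq> 0\<close>, then \<open>g(z\<^sup>p) \<noteq> 0\<close>, so \<open>k(z\<^sup>p) = 0\<close> and by the
  Frobenius identity \<open>p\<close> divides \<open>k(z)\<^sup>p\<close> in \<open>\<int>[z]\<close>. But \<open>k(z)\<close> divides \<open>n\<close>, because differentiating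
  \<open>X\<^sup>n - 1 = g k\<close> gives \<open>n z\<^bsup>n-1\<^esup> = g'(z) k(z)\<close>. So \<open>p\<close> divides \<open>n\<^sup>p\<close> in \<open>\<int>[z]\<close>, and, being coprime to it,
  is a unit there.\<close>

lemma root_of_unity_prime_conjugate:
  assumes n: "n > 0" and z: "z ^ n = 1" and p: "prime p" "\<not> p dvd n" and f: "ipoly f z = 0"
  shows "ipoly f (z ^ p) = 0"
proof (rule ccontr)
  assume nz: "ipoly f (z ^ p) \<noteq> 0"
  let ?u = "monom 1 n - 1 :: int poly"
  have "degree ?u = n" using n by (rule degree_monom_minus_one)
  then have u: "?u \<noteq> 0" "ipoly ?u z = 0" using z n by (metis degree_0 less_irrefl, simp)
  obtain g where g: "g \<noteq> 0" "ipoly g z = 0" "\<And>f. ipoly f z = 0 \<Longrightarrow> g dvd f"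
    using integral_minimal_poly[OF u] by blast
  obtain k where k: "?u = g * k" using g(3)[OF u(2)] by blast
  obtain f' where "f = g * f'" using g(3)[OF f] by blast
  with nz have gp: "ipoly g (z ^ p) \<noteq> 0" by auto
  have "ipoly ?u (z ^ p) = (z ^ n) ^ p - 1" by (simp add: mult.commute flip: power_mult)
  then have "ipoly (g * k) (z ^ p) = 0" using z by (simp flip: k)
  with gp have kp: "ipoly k (z ^ p) = 0" by simp
  obtain r where r: "pcompose k (monom 1 p) = k ^ p + of_nat p * r"
    using frobenius_int_poly[OF p(1)] by blast
  have "ipoly (pcompose k (monom 1 p)) z = 0" using kp by simp
  then have kr: "ipoly k z ^ p = - (of_nat p * ipoly r z)" 
    by (simp add: r eq_neg_iff_add_eq_0)
  have "pderiv ?u = monom (int n) (n - 1)" by (simp add: pderiv_diff pderiv_monom)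
  then have "monom (int n) (n - 1) = g * pderiv k + k * pderiv g" by (simp add: k pderiv_mult)
  then have "ipoly (monom (int n) (n - 1)) z = ipoly (g * pderiv k + k * pderiv g) z" by (rule arg_cong)
  then have der: "of_nat n * z ^ (n - 1) = ipoly k z * ipoly (pderiv g) z" using g(2) by simp
  have "of_nat n = z * (of_nat n * z ^ (n - 1))" using n z
    by (metis mult.left_commute mult.right_neutral power_eq_if less_numeral_extra(3))
  also have "\<dots> = ipoly k z * (z * ipoly (pderiv g) z)" using der by simp
  finally have "of_nat n ^ p = (ipoly k z * (z * ipoly (pderiv g) z)) ^ p" by simp
  also have "\<dots> = of_nat p * ipoly (- r * ([:0, 1:] * pderiv g) ^ p) z"
    by (simp add: power_mult_distrib kr)
  finally obtain s where s: "of_nat n ^ p = of_nat p * ipoly s z" by blast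
  have "coprime (int n ^ p) (int p)"
    using prime_imp_coprime[OF p] by (simp add: coprime_commute)
  then obtain a b where "a * int n ^ p + b * int p = 1"
    by (metis bezout_int coprime_imp_gcd_eq_1)
  then have "of_int (a * int n ^ p + b * int p) = (1::complex)" by simp
  then have "of_nat p * ipoly (smult a s + [:b:]) z = 1" using s by (simp add: algebra_simps)
  with prime_not_unit_at_root_of_unity[OF n z p(1)] show False by blast
qed

text \<open>One prime factor of \<open>u\<close> at a time: \<open>z\<^sup>p\<close> is again an \<open>n\<close>-th root of unity.\<close>

lemma root_of_unity_coprime_conjugate:
  assumes "n > 0" "z ^ n = 1" "coprime u n" "ipoly f z = 0" "u > 0"
  shows "ipoly f (z ^ u) = 0"
  using assms
proof (induction u arbitrary: z rule: less_induct)
  case (less u)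
  show ?case
  proof (cases "u = 1")
    case True
    then show ?thesis using less.prems by simp
  next
    case False
    then obtain p where p: "prime p" "p dvd u" using prime_factor_nat by blast
    then obtain v where v: "u = p * v" by blast
    have "\<not> p dvd n"
      using p less.prems(3) by (meson coprime_common_divisor not_prime_unit)
    moreover have "(z ^ p) ^ n = 1" using less.prems(2) by (metis mult.commute power_mult power_one)
    moreover have "v < u" "v > 0" "coprime v n"
      using v p less.prems prime_gt_1_nat[OF p(1)] by auto
    ultimately have "ipoly f ((z ^ p) ^ v) = 0"
      using less.IH[of v "z ^ p"] less.prems root_of_unity_prime_conjugate p by blast
    then show ?thesis by (simp add: v power_mult)
  qed
qed

section \<open>Relations between the roots of unity\<close>

lemma unity_root_add: "unity_root n (a + b) = unity_root n a * unity_root n b"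
  by (simp add: unity_root_def cis_mult add_divide_distrib distrib_left)

lemma unity_root_nonzero [simp]: "unity_root n a \<noteq> 0"
  by (simp add: unity_root_def)

lemma unity_root_power: "unity_root n (int u * a) = unity_root n a ^ u"
  by (simp add: unity_root_def DeMoivre mult_ac)

lemma unity_root_eq_1_iff:
  assumes "n > 0"
  shows "unity_root n k = 1 \<longleftrightarrow> int n dvd k"
proof
  assume "unity_root n k = 1"
  then have "cos (2 * pi * of_int k / of_nat n) = 1"
    by (metis unity_root_def cis.sel(1) one_complex.sel(1))
  then obtain j :: int where "2 * pi * of_int k / of_nat n = of_int j * 2 * pi"
    using cos_one_2pi_int by blast
  then have "real_of_int k = of_int (j * int n)" using assms by (simp add: field_simps)
  then have "k = j * int n" by (simp only: of_int_eq_iff)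
  then show "int n dvd k" by simp
next
  assume "int n dvd k"
  then obtain j where "k = int n * j" by blast
  then have "2 * pi * real_of_int k / of_nat n = 2 * pi * of_int j" using assms by simp
  then show "unity_root n k = 1"
    unfolding unity_root_def by (metis Ints_of_int cis_multiple_2pi)
qed

lemma unity_root_eq_iff:
  assumes "n > 0"
  shows "unity_root n a = unity_root n b \<longleftrightarrow> [a = b] (mod int n)"
proof -
  have "unity_root n a = unity_root n (a - b) * unity_root n b"
    by (simp flip: unity_root_add)
  then have "unity_root n a = unity_root n b \<longleftrightarrow> unity_root n (a - b) = 1" by simp
  then show ?thesis using unity_root_eq_1_iff[OF assms] by (simp add: cong_iff_dvd_diff)
qed

lemma unity_root_mod [simp]: "n > 0 \<Longrightarrow> unity_root n (a mod int n) = unity_root n a"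
  by (simp add: unity_root_eq_iff)

lemma unity_root_minus_half:
  assumes "n > 0" "even n" "[a = b] (mod int (n div 2))"
  shows "unity_root n a \<in> {unity_root n b, - unity_root n b}"
proof -
  obtain k where "a - b = int (n div 2) * k" using assms(3) by (auto simp: cong_iff_dvd_diff)
  then have "2 * (a - b) = int n * k" using assms(2) by (auto elim!: evenE)
  then have "int n dvd int 2 * (a - b)" by simp
  then have "unity_root n (a - b) ^ 2 = 1"
    using unity_root_eq_1_iff[OF assms(1)] by (simp flip: unity_root_power)
  then have "unity_root n (a - b) = 1 \<or> unity_root n (a - b) = - 1"
    by (simp add: power2_eq_1_iff)
  moreover have "unity_root n a = unity_root n (a - b) * unity_root n b"
    by (simp flip: unity_root_add)
  ultimately show ?thesis by auto
qed

definition periodic :: "nat \<Rightarrow> (int \<Rightarrow> 'a) \<Rightarrow> bool" where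
  "periodic d h \<longleftrightarrow> (\<forall>x y. [x = y] (mod int d) \<longrightarrow> h x = h y)"

text \<open>A function on \<open>Z\<^sub>n\<close> is represented by a function on \<open>\<int>\<close>, of which only the values on
  \<open>{0..<n}\<close> matter here; this lets periodic functions be shifted without reduction modulo \<open>n\<close>.\<close>

definition vanishing :: "nat \<Rightarrow> (int \<Rightarrow> complex) \<Rightarrow> bool" where
  "vanishing n f \<longleftrightarrow> (\<Sum>x\<in>{0..<int n}. f x * unity_root n x) = 0"

text \<open>The shift invariance behind both the orthogonality of the characters and the fact that a
  function constant on the cosets of \<open>Z\<^sub>q\<close> is a relation.\<close>

lemma sum_shift_periodic:
  fixes g :: "int \<Rightarrow> 'a::comm_monoid_add"
  assumes "n > 0" "periodic n g"
  shows "(\<Sum>x\<in>{0..<int n}. g (x + t)) = (\<Sum>x\<in>{0..<int n}. g x)"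
proof (rule sum.reindex_bij_witness[where i = "\<lambda>x. (x - t) mod int n" and j = "\<lambda>x. (x + t) mod int n"])
  fix x assume "x \<in> {0..<int n}"
  then show "((x + t) mod int n - t) mod int n = x" "((x - t) mod int n + t) mod int n = x"
    by (simp_all add: mod_simps)
  have "[(x + t) mod int n = x + t] (mod int n)" by (simp add: cong_def)
  then show "g ((x + t) mod int n) = g (x + t)" using assms(2) by (simp add: periodic_def)
qed (use assms in auto)

lemma periodic_unity_root: "n > 0 \<Longrightarrow> periodic n (\<lambda>x. unity_root n (u * x))"
  by (auto simp: periodic_def unity_root_eq_iff intro: cong_scalar_left)

lemma periodic_dvd: "periodic d h \<Longrightarrow> d dvd n \<Longrightarrow> periodic n h"
  unfolding periodic_def by (meson cong_dvd_modulus int_dvd_int_iff)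

lemma sum_unity_root_orthogonality:
  assumes "n > 0"
  shows "(\<Sum>u\<in>{0..<int n}. unity_root n (u * k)) = (if int n dvd k then of_nat n else 0)"
proof (cases "int n dvd k")
  case True
  then have "unity_root n (u * k) = 1" for u using unity_root_eq_1_iff[OF assms] by simp
  then show ?thesis using True by simp
next
  case False
  let ?S = "\<Sum>u\<in>{0..<int n}. unity_root n (u * k)"
  have "?S = (\<Sum>u\<in>{0..<int n}. unity_root n ((u + 1) * k))"
    using sum_shift_periodic[OF assms, of "\<lambda>u. unity_root n (u * k)" 1]
      periodic_unity_root[OF assms, of k] by (simp add: mult.commute)
  also have "\<dots> = unity_root n k * ?S"
    by (simp add: distrib_right unity_root_add sum_distrib_left mult.commute[of _ "unity_root n k"])
  finally have "(1 - unity_root n k) * ?S = 0" by (simp add: algebra_simps)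
  then show ?thesis using False unity_root_eq_1_iff[OF assms] by auto
qed

lemma fourier_inversion:
  fixes f :: "int \<Rightarrow> complex"
  assumes "n > 0" "y \<in> {0..<int n}"
  shows "(\<Sum>u\<in>{0..<int n}. (\<Sum>x\<in>{0..<int n}. f x * unity_root n (u * x)) * unity_root n (- (u * y)))
    = of_nat n * f y"
proof -
  have "(\<Sum>u\<in>{0..<int n}. (\<Sum>x\<in>{0..<int n}. f x * unity_root n (u * x)) * unity_root n (- (u * y)))
      = (\<Sum>u\<in>{0..<int n}. \<Sum>x\<in>{0..<int n}. f x * unity_root n (u * (x - y)))"
    unfolding sum_distrib_right
    by (intro sum.cong refl) (simp add: right_diff_distrib mult.assoc flip: unity_root_add)
  also have "\<dots> = (\<Sum>x\<in>{0..<int n}. f x * (\<Sum>u\<in>{0..<int n}. unity_root n (u * (x - y))))"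
    by (subst sum.swap) (simp add: sum_distrib_left)
  also have "\<dots> = (\<Sum>x\<in>{0..<int n}. if x = y then of_nat n * f y else 0)"
  proof (intro sum.cong refl)
    fix x assume "x \<in> {0..<int n}"
    then have "int n dvd x - y \<longleftrightarrow> x = y"
      using assms(2) by (auto simp flip: cong_iff_dvd_diff simp: cong_def)
    then show "f x * (\<Sum>u\<in>{0..<int n}. unity_root n (u * (x - y))) = (if x = y then of_nat n * f y else 0)"
      by (simp add: sum_unity_root_orthogonality[OF assms(1)])
  qed
  finally show ?thesis using assms(2) by simp
qed

text \<open>The Fourier transform of a relation vanishes at the units of \<open>Z\<^sub>n\<close>.\<close>

lemma vanishing_conjugate:
  fixes f :: "int \<Rightarrow> int"
  assumes n: "n > 0" and f: "vanishing n (\<lambda>x. of_int (f x))" and u: "coprime u n" "u > 0"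
  shows "(\<Sum>x\<in>{0..<int n}. of_int (f x) * unity_root n (int u * x)) = 0"
proof -
  let ?p = "\<Sum>x\<in>{0..<int n}. monom (f x) (nat x)"
  have ev: "ipoly ?p (unity_root n 1 ^ k) = (\<Sum>x\<in>{0..<int n}. of_int (f x) * unity_root n (int k * x))" for k
  proof -
    have "(unity_root n 1 ^ k) ^ nat x = unity_root n (int k * x)" if "x \<ge> 0" for x
      using that by (simp add: mult_ac flip: power_mult unity_root_power)
    then show ?thesis by simp
  qed
  have "ipoly ?p (unity_root n 1) = 0"
    using ev[of 1] f by (simp add: vanishing_def)
  moreover have "unity_root n 1 ^ n = 1"
    using unity_root_eq_1_iff[OF n, of "int n"] by (simp flip: unity_root_power)
  ultimately show ?thesis
    using root_of_unity_coprime_conjugate[OF n _ u(1) _ u(2), of "unity_root n 1" ?p]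
    by (simp only: ev)
qed

text \<open>In the Fourier expansion of a relation only frequencies \<open>u\<close> that are not coprime to \<open>n\<close> survive.
  For a prime \<open>q\<close> dividing \<open>u\<close> and \<open>n\<close>, the character \<open>x \<mapsto> \<omega>\<^bsup>-ux\<^esup>\<close> has period \<open>n/q\<close>; so the frequencies
  are distributed among the primes by choosing one such \<open>q\<close> for each \<open>u\<close>.\<close>

lemma vanishing_decomposition:
  fixes f :: "int \<Rightarrow> int"
  assumes n: "n \<ge> 2" and f: "vanishing n (\<lambda>x. of_int (f x))"
  obtains h :: "nat \<Rightarrow> int \<Rightarrow> complex"
  where "\<And>q. q \<in> prime_factors n \<Longrightarrow> periodic (n div q) (h q)"
    and "\<And>x. x \<in> {0..<int n} \<Longrightarrow> of_int (f x) = (\<Sum>q\<in>prime_factors n. h q x)"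
proof -
  define F where "F u = (\<Sum>x\<in>{0..<int n}. of_int (f x) * unity_root n (u * x))" for u
  define N where "N = {u \<in> {0..<int n}. \<not> coprime u (int n)}"
  have n0: "n > 0" using n by simp
  have F0: "F u = 0" if "u \<in> {0..<int n} - N" for u
  proof -
    have c: "coprime (nat u) n" using that by (simp add: N_def flip: coprime_int_iff)
    then have "nat u \<noteq> 0" using n by auto
    then show ?thesis
      using vanishing_conjugate[OF n0 f c] that by (simp add: F_def N_def)
  qed
  have "\<exists>q. q \<in> prime_factors n \<and> int q dvd u" if "u \<in> N" for u
  proof -
    have "\<not> coprime (nat u) n" using that by (simp add: N_def flip: coprime_int_iff)
    then obtain q where "prime q" "q dvd nat u" "q dvd n"
      by (metis coprime_iff_gcd_eq_1 dvd_trans gcd_dvd1 gcd_dvd2 prime_factor_nat)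
    then show ?thesis using n that
      by (auto simp: N_def in_prime_factors_iff int_dvd_int_iff[symmetric] simp del: int_dvd_int_iff)
  qed
  then obtain \<pi> where \<pi>: "\<And>u. u \<in> N \<Longrightarrow> \<pi> u \<in> prime_factors n \<and> int (\<pi> u) dvd u" by metis
  define h where "h q y = (\<Sum>u\<in>{u\<in>N. \<pi> u = q}. F u * unity_root n (- (u * y))) / of_nat n" for q y
  show thesis
  proof (rule that[of h])
    fix q assume q: "q \<in> prime_factors n"
    show "periodic (n div q) (h q)"
      unfolding periodic_def
    proof (intro allI impI)
      fix x y assume xy: "[x = y] (mod int (n div q))"
      have "unity_root n (- (u * x)) = unity_root n (- (u * y))" if u: "u \<in> N" "\<pi> u = q" for u
      proof -
        obtain v where v: "u = int q * v" using \<pi> u by blast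
        have "n = q * (n div q)" using q by auto
        then have nq: "int n = int q * int (n div q)" by (metis of_nat_mult)
        obtain k where "x - y = int (n div q) * k" using xy by (auto simp: cong_iff_dvd_diff)
        then have "u * (x - y) = int n * (v * k)" unfolding v nq by (simp only: mult_ac)
        then have "int n dvd u * (x - y)" by simp
        then have "[u * x = u * y] (mod int n)"
          by (simp add: cong_iff_dvd_diff right_diff_distrib)
        then show ?thesis using n0 by (simp add: unity_root_eq_iff cong_minus_minus_iff)
      qed
      then show "h q x = h q y" unfolding h_def by simp
    qed
  next
    fix x assume x: "x \<in> {0..<int n}"
    have finN: "finite N" unfolding N_def by (rule finite_subset[of _ "{0..<int n}"]) auto
    have "of_nat n * of_int (f x) = (\<Sum>u\<in>{0..<int n}. F u * unity_root n (- (u * x)))"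
      unfolding F_def using fourier_inversion[OF n0 x, of "\<lambda>x. of_int (f x)"] by simp
    also have "\<dots> = (\<Sum>u\<in>N. F u * unity_root n (- (u * x)))"
      using F0 by (intro sum.mono_neutral_right) (auto simp: N_def)
    also have "\<dots> = (\<Sum>q\<in>prime_factors n. \<Sum>u\<in>{u\<in>N. \<pi> u = q}. F u * unity_root n (- (u * x)))"
      using \<pi> finN by (intro sum.group[symmetric]) auto
    finally show "of_int (f x) = (\<Sum>q\<in>prime_factors n. h q x)"
      using n0 by (simp add: h_def field_simps flip: sum_divide_distrib)
  qed
qed

text \<open>Shifting the summation by \<open>n/q\<close> multiplies the sum by \<open>\<omega>\<^bsup>n/q\<^esup> \<noteq> 1\<close>.\<close>

lemma vanishing_periodic:
  assumes n: "n > 0" and q: "q \<in> prime_factors n" and h: "periodic (n div q) h"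
  shows "vanishing n h"
proof -
  let ?t = "int (n div q)" and ?S = "\<Sum>x\<in>{0..<int n}. h x * unity_root n x"
  have qn: "prime q" "q dvd n" using q by auto
  have "n div q dvd n" using qn(2) by (metis dvd_div_mult_self dvd_triv_left)
  then have "periodic n h" using h periodic_dvd by blast
  then have per: "periodic n (\<lambda>x. h x * unity_root n x)"
    using periodic_unity_root[OF n, of 1] unfolding periodic_def mult_1 by metis
  have "h (x + ?t) = h x" for x
    using h unfolding periodic_def by (metis cong_add_rcancel_0 cong_def mod_add_self2)
  then have "?S = unity_root n ?t * ?S"
    using sum_shift_periodic[OF n per, of ?t]
    by (simp add: unity_root_add sum_distrib_left mult_ac)
  then have "(1 - unity_root n ?t) * ?S = 0" by (simp add: algebra_simps)
  moreover have "0 < n div q" "n div q < n"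
    using qn n prime_gt_1_nat[OF qn(1)] by (auto intro: Nat.gr0I simp: dvd_div_eq_0_iff)
  then have "unity_root n ?t \<noteq> 1"
    using unity_root_eq_1_iff[OF n] by (auto dest: dvd_imp_le)
  ultimately show ?thesis by (simp add: vanishing_def)
qed

lemma vanishing_sum:
  assumes "\<And>i. i \<in> I \<Longrightarrow> vanishing n (h i)"
  shows "vanishing n (\<lambda>x. \<Sum>i\<in>I. h i x)"
  using assms by (auto simp: vanishing_def sum_distrib_right sum.swap[of _ I])

lemma vanishing_cong:
  assumes "\<And>x. x \<in> {0..<int n} \<Longrightarrow> f x = g x"
  shows "vanishing n f \<longleftrightarrow> vanishing n g"
  using assms by (simp add: vanishing_def)

text \<open>Congruence modulo \<open>n/q\<close> is the relation of lying in the same coset of \<open>Z\<^sub>q\<close>.\<close>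

definition respects_prime_cosets :: "nat \<Rightarrow> (int \<Rightarrow> int) \<Rightarrow> bool" where
  "respects_prime_cosets n \<sigma> \<longleftrightarrow> (\<forall>q\<in>prime_factors n. \<forall>x\<in>{0..<int n}. \<forall>y\<in>{0..<int n}.
     [x = y] (mod int (n div q)) \<longrightarrow> [\<sigma> x = \<sigma> y] (mod int (n div q)))"

text \<open>If \<open>f = \<Sum>\<^sub>q h\<^sub>q\<close> with \<open>h\<^sub>q\<close> constant on the cosets of \<open>Z\<^sub>q\<close>, then \<open>f \<circ> \<sigma> = \<Sum>\<^sub>q h\<^sub>q \<circ> \<sigma>\<close> is a decomposition of
  the same kind.\<close>

lemma vanishing_comp:
  fixes f :: "int \<Rightarrow> int"
  assumes n: "n \<ge> 2" and f: "vanishing n (\<lambda>x. of_int (f x))"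
    and \<sigma>: "\<sigma> \<in> {0..<int n} \<rightarrow> {0..<int n}" "respects_prime_cosets n \<sigma>"
  shows "vanishing n (\<lambda>x. of_int (f (\<sigma> x)))"
proof -
  obtain h :: "nat \<Rightarrow> int \<Rightarrow> complex"
    where h: "\<And>q. q \<in> prime_factors n \<Longrightarrow> periodic (n div q) (h q)"
    and fh: "\<And>x. x \<in> {0..<int n} \<Longrightarrow> of_int (f x) = (\<Sum>q\<in>prime_factors n. h q x)"
    using vanishing_decomposition[OF n f] by metis
  have "vanishing n (\<lambda>x. \<Sum>q\<in>prime_factors n. h q (\<sigma> (x mod int n)))"
  proof (intro vanishing_sum vanishing_periodic)
    fix q assume q: "q \<in> prime_factors n"
    show "periodic (n div q) (\<lambda>x. h q (\<sigma> (x mod int n)))"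
      unfolding periodic_def
    proof (intro allI impI)
      fix x y assume xy: "[x = y] (mod int (n div q))"
      have "int (n div q) dvd int n"
        using q by (metis dvd_div_mult_self dvd_triv_left in_prime_factors_iff int_dvd_int_iff)
      then have "[x mod int n = y mod int n] (mod int (n div q))"
        using xy by (simp add: cong_def mod_mod_cancel)
      then have "[\<sigma> (x mod int n) = \<sigma> (y mod int n)] (mod int (n div q))"
        using \<sigma>(2) q n by (simp add: respects_prime_cosets_def)
      then show "h q (\<sigma> (x mod int n)) = h q (\<sigma> (y mod int n))"
        using h[OF q] by (simp add: periodic_def)
    qed
  qed (use n in auto)
  then show ?thesis
  proof (rule iffD1[OF vanishing_cong, rotated])
    fix x assume x: "x \<in> {0..<int n}"
    then have "\<sigma> x \<in> {0..<int n}" using \<sigma>(1) by auto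
    then show "(\<Sum>q\<in>prime_factors n. h q (\<sigma> (x mod int n))) = of_int (f (\<sigma> x))"
      using fh x by simp
  qed
qed

text \<open>The cosets of \<open>Z\<^bsub>n/m\<^esub>\<close> are unions of cosets of each \<open>Z\<^sub>q\<close>, so cutting \<open>h\<^sub>q\<close> down to one of them leaves it
  constant on the cosets of \<open>Z\<^sub>q\<close>.\<close>

lemma vanishing_restrict_class:
  fixes f :: "int \<Rightarrow> int"
  assumes n: "n \<ge> 2" and f: "vanishing n (\<lambda>x. of_int (f x))"
    and m: "\<And>q. q \<in> prime_factors n \<Longrightarrow> m dvd n div q"
  shows "vanishing n (\<lambda>x. of_int (if [x = c] (mod int m) then f x else 0))"
proof -
  obtain h :: "nat \<Rightarrow> int \<Rightarrow> complex"
    where h: "\<And>q. q \<in> prime_factors n \<Longrightarrow> periodic (n div q) (h q)"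
    and fh: "\<And>x. x \<in> {0..<int n} \<Longrightarrow> of_int (f x) = (\<Sum>q\<in>prime_factors n. h q x)"
    using vanishing_decomposition[OF n f] by metis
  have "vanishing n (\<lambda>x. \<Sum>q\<in>prime_factors n. if [x = c] (mod int m) then h q x else 0)"
  proof (intro vanishing_sum vanishing_periodic)
    fix q assume q: "q \<in> prime_factors n"
    have "periodic (n div q) (\<lambda>x. [x = c] (mod int m))"
      by (rule periodic_dvd[OF _ m[OF q]]) (auto simp: periodic_def cong_def)
    then show "periodic (n div q) (\<lambda>x. if [x = c] (mod int m) then h q x else 0)"
      using h[OF q] unfolding periodic_def by metis
  qed (use n in auto)
  then show ?thesis
    by (rule iffD1[OF vanishing_cong, rotated]) (use fh in auto)
qed

text \<open>For prime \<open>n = q\<close> there is a single summand \<open>h\<^sub>q\<close>, and its period is \<open>1\<close>.\<close>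

lemma vanishing_prime_const:
  fixes f :: "int \<Rightarrow> int"
  assumes q: "prime q" and f: "vanishing q (\<lambda>x. of_int (f x))" and xy: "x \<in> {0..<int q}" "y \<in> {0..<int q}"
  shows "f x = f y"
proof -
  have pf: "prime_factors q = {q}" using q by (simp add: prime_prime_factors)
  obtain h :: "nat \<Rightarrow> int \<Rightarrow> complex"
    where h: "\<And>r. r \<in> prime_factors q \<Longrightarrow> periodic (q div r) (h r)"
    and fh: "\<And>x. x \<in> {0..<int q} \<Longrightarrow> of_int (f x) = (\<Sum>r\<in>prime_factors q. h r x)"
    using vanishing_decomposition[OF prime_ge_2_nat[OF q] f] by metis
  have "periodic 1 (h q)" using h[of q] q by (simp add: pf)
  then have "h q x = h q y" unfolding periodic_def by (simp add: cong_def)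
  then have "complex_of_int (f x) = of_int (f y)" using fh xy by (simp add: pf)
  then show ?thesis by simp
qed

section \<open>Subgroups, cosets and components of \<open>Z\<^sub>n\<close> in terms of congruences\<close>

lemma Zsub_iff:
  assumes "n > 0" "d dvd n"
  shows "x \<in> Zsub n d \<longleftrightarrow> x \<in> {0..<int n} \<and> int (n div d) dvd x"
proof -
  let ?t = "int (n div d)"
  have "n div d > 0" using assms by (metis dvd_div_eq_0_iff gr0I)
  then have t: "?t > 0" by simp
  have "n = n div d * d" using assms by simp
  then have nt: "int n = ?t * int d" by (metis of_nat_mult)
  have "?t * k \<in> {0..<int n} \<longleftrightarrow> k \<in> {0..<int d}" for k
    using t by (simp add: nt zero_le_mult_iff)
  then show ?thesis unfolding Zsub_eq[OF assms] dvd_def image_iff by metis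
qed

lemma rcoset_Zsub_iff:
  assumes n: "n > 0" and d: "d dvd n"
  shows "y \<in> Zsub n d #>\<^bsub>Z n\<^esub> x \<longleftrightarrow> y \<in> {0..<int n} \<and> [y = x] (mod int (n div d))"
proof -
  have dn: "int (n div d) dvd int n"
    using d by (metis dvd_div_mult_self dvd_triv_left int_dvd_int_iff)
  show ?thesis
  proof
    assume "y \<in> Zsub n d #>\<^bsub>Z n\<^esub> x"
    then obtain h where h: "h \<in> Zsub n d" "y = (h + x) mod int n" by (auto simp: r_coset_def)
    have "[y = h + x] (mod int (n div d))" using h(2) dn by (simp add: cong_def mod_mod_cancel)
    moreover have "[h + x = 0 + x] (mod int (n div d))"
      using h(1) by (intro cong_add) (simp_all add: Zsub_iff[OF n d] cong_0_iff)
    ultimately show "y \<in> {0..<int n} \<and> [y = x] (mod int (n div d))"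
      using n h(2) cong_trans by fastforce
  next
    assume y: "y \<in> {0..<int n} \<and> [y = x] (mod int (n div d))"
    let ?h = "(y - x) mod int n"
    have "?h \<in> Zsub n d"
      using y n dn by (simp add: Zsub_iff[OF n d] cong_iff_dvd_diff dvd_mod)
    moreover have "y = (?h + x) mod int n" using y by (simp add: mod_simps)
    ultimately show "y \<in> Zsub n d #>\<^bsub>Z n\<^esub> x" by (auto simp: r_coset_def)
  qed
qed

lemma finprod_integer_mod_group:
  assumes "finite I" "x \<in> I \<rightarrow> carrier (Z n)"
  shows "(\<Otimes>\<^bsub>Z n\<^esub>i\<in>I. x i) = (\<Sum>i\<in>I. x i) mod int n"
proof -
  interpret comm_group "Z n" by simp
  show ?thesis using assms
    by (induction I rule: finite_induct) (simp_all add: Pi_iff mod_simps)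
qed

text \<open>With \<open>g q = q\<^sup>k\<close> the exact power of \<open>q\<close> in \<open>n\<close> this is the decomposition of \<open>Z\<^sub>n\<close> into primary
  components; with \<open>g q = q\<close> it says that the subgroups \<open>Z\<^sub>q\<close> generate \<open>Z\<^bsub>rad n\<^esub>\<close>.\<close>

lemma sum_of_coprime_parts:
  fixes g :: "'a \<Rightarrow> nat"
  assumes "finite P" "\<And>q r. q \<in> P \<Longrightarrow> r \<in> P \<Longrightarrow> q \<noteq> r \<Longrightarrow> coprime (g q) (g r)"
    and "(\<Prod>q\<in>P. g q) dvd n" "int (n div (\<Prod>q\<in>P. g q)) dvd x" "n > 0"
  shows "\<exists>y. (\<forall>q\<in>P. int (n div g q) dvd y q) \<and> [x = (\<Sum>q\<in>P. y q)] (mod int n)"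
  using assms
proof (induction P arbitrary: x rule: finite_induct)
  case empty
  then show ?case by (simp add: cong_0_iff)
next
  case (insert r P)
  let ?M = "\<Prod>q\<in>P. g q"
  obtain c where "n = (\<Prod>q\<in>insert r P. g q) * c" using insert.prems(2) by blast
  then have c: "n = ?M * g r * c" using insert.hyps by (simp add: mult_ac)
  have pos: "?M > 0" "g r > 0" using c insert.prems(4) by (auto intro!: Nat.gr0I)
  have "n div (g r * ?M) = c" using c pos by simp
  then have "int c dvd x" using insert.prems(3) insert.hyps by simp
  then obtain z where z: "x = int c * z" by blast
  have "coprime ?M (g r)" using insert.prems(1) insert.hyps by (intro prod_coprime_left) auto
  then have "coprime (int ?M) (int (g r))" by (simp only: coprime_int_iff)
  then obtain a b where ab: "a * int ?M + b * int (g r) = 1"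
    by (metis bezout_int coprime_imp_gcd_eq_1)
  have "n div ?M = g r * c" "n div g r = ?M * c" unfolding c using pos by (simp_all add: mult_ac)
  then have d1: "int (n div ?M) dvd int c * z * b * int (g r)"
    and d2: "int (n div g r) dvd int c * z * a * int ?M"
    by (simp_all add: mult_ac del: of_nat_prod)
  obtain y where y: "\<forall>q\<in>P. int (n div g q) dvd y q" "[int c * z * b * int (g r) = (\<Sum>q\<in>P. y q)] (mod int n)"
    using insert.IH[OF _ _ d1] insert.prems c by (auto simp: mult_ac)
  have "x = int c * z * (a * int ?M + b * int (g r))" by (simp only: ab z)
  also have "\<dots> = int c * z * a * int ?M + int c * z * b * int (g r)"
    by (simp only: distrib_left mult.assoc)
  also have "[int c * z * a * int ?M + int c * z * b * int (g r)
      = int c * z * a * int ?M + (\<Sum>q\<in>P. y q)] (mod int n)"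
    using y(2) by (intro cong_add cong_refl)
  also have "int c * z * a * int ?M + (\<Sum>q\<in>P. y q)
      = (\<Sum>q\<in>insert r P. (y(r := int c * z * a * int ?M)) q)"
    using insert.hyps by (auto intro!: sum.cong)
  finally have "[x = (\<Sum>q\<in>insert r P. (y(r := int c * z * a * int ?M)) q)] (mod int n)" .
  moreover have "\<forall>q\<in>insert r P. int (n div g q) dvd (y(r := int c * z * a * int ?M)) q"
    using y(1) d2 by simp
  ultimately show ?case by blast
qed

lemma rad_dvd:
  assumes "n > 0"
  shows "rad n dvd n"
proof -
  have "(\<Prod>q\<in>prime_factors n. q) dvd (\<Prod>q\<in>prime_factors n. q ^ multiplicity q n)"
    by (intro prod_dvd_prod) (simp add: prime_factors_multiplicity dvd_power)
  then show ?thesis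
    unfolding rad_def using prime_factorization_nat[OF assms] by simp
qed

lemma div_dvd_div_antimono:
  fixes n :: nat
  assumes "n > 0" "d dvd e" "e dvd n"
  shows "n div e dvd n div d"
proof -
  obtain k where k: "e = d * k" using assms(2) by blast
  obtain c where c: "n = e * c" using assms(3) by blast
  have "d > 0" "e > 0" using assms(1) k c by auto
  then have "n div e = c" "n div d = k * c" using c k by simp_all
  then show ?thesis by simp
qed

section \<open>Sets without relations and the permutations that preserve them\<close>

text \<open>On a finite set one direction is enough: a permutation induces an injective map from the
  finitely many subsets with the property to themselves, and such a map is onto.\<close>

lemma bij_betw_preserves_iff:
  assumes "finite X" "bij_betw \<sigma> X X" "\<And>F. F \<subseteq> X \<Longrightarrow> Q F \<Longrightarrow> Q (\<sigma> ` F)" "F \<subseteq> X"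
  shows "Q F \<longleftrightarrow> Q (\<sigma> ` F)"
proof
  assume QF: "Q (\<sigma> ` F)"
  let ?S = "{F \<in> Pow X. Q F}"
  have inj: "inj_on ((`) \<sigma>) (Pow X)"
    using assms(2) by (auto simp: bij_betw_def intro: inj_on_image_Pow)
  have maps: "\<sigma> ` G \<subseteq> X" if "G \<subseteq> X" for G using assms(2) that by (auto simp: bij_betw_def)
  have "(`) \<sigma> ` ?S = ?S"
  proof (rule endo_inj_surj)
    show "finite ?S" using assms(1) by simp
    show "(`) \<sigma> ` ?S \<subseteq> ?S" using assms(3) maps by auto
    show "inj_on ((`) \<sigma>) ?S" using inj by (rule inj_on_subset) auto
  qed
  then have "\<sigma> ` F \<in> (`) \<sigma> ` ?S" using QF maps assms(4) by auto
  then obtain G where "G \<in> ?S" "\<sigma> ` F = \<sigma> ` G" by auto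
  then show "Q F" using inj assms(4) by (auto dest: inj_onD)
qed (use assms in blast)

text \<open>The set \<open>A\<close> of admissible coefficients is \<open>UNIV\<close> for independence and \<open>{0, 1, -1}\<close> for
  quasi-independence. The arguments below use only that it contains \<open>0\<close> and \<open>1\<close> and is symmetric.\<close>

locale root_of_unity_relations =
  fixes n :: nat and A :: "int set"
  assumes n2: "n \<ge> 2" and zero_A: "0 \<in> A" and one_A: "1 \<in> A"
    and minus_A: "\<And>a. a \<in> A \<Longrightarrow> - a \<in> A"
begin

abbreviation C :: "int set" where "C \<equiv> {0..<int n}"

abbreviation m :: nat where "m \<equiv> n div rad n"

definition free :: "int set \<Rightarrow> bool" where
  "free F \<longleftrightarrow> (\<forall>f. (\<forall>x. f x \<in> A) \<and> (\<forall>x. x \<notin> F \<longrightarrow> f x = 0) \<and> vanishing n (\<lambda>x. of_int (f x))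
     \<longrightarrow> (\<forall>x. f x = 0))"

definition free_preserving :: "int set \<Rightarrow> (int \<Rightarrow> int) \<Rightarrow> bool" where
  "free_preserving X \<sigma> \<longleftrightarrow> bij_betw \<sigma> X X \<and> (\<forall>F\<subseteq>X. free F \<longleftrightarrow> free (\<sigma> ` F))"

lemma n_pos: "n > 0" using n2 by simp

lemma C_carrier: "carrier (Z n) = C"
  using n_pos by (simp add: carrier_integer_mod_group)

lemma mod_in_C [simp]: "x mod int n \<in> C"
  using n_pos by simp

lemma prime_div:
  assumes "q \<in> prime_factors n"
  shows "n div q dvd n" "m dvd n div q" "int (n div q) dvd int n" "q * (n div q) = n" "prime q"
proof -
  show *: "q * (n div q) = n" "prime q" using assms by auto
  show "n div q dvd n" using *(1) by (metis dvd_triv_right)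
  then show "int (n div q) dvd int n" by simp
  have "q dvd rad n" using assms unfolding rad_def by (intro dvd_prodI) auto
  moreover have "rad n dvd n" using n_pos by (rule rad_dvd)
  ultimately show "m dvd n div q" using div_dvd_div_antimono[OF n_pos] by blast
qed

lemma m_dvd_n: "int m dvd int n"
  using rad_dvd[OF n_pos] by (metis dvd_div_mult_self dvd_triv_left int_dvd_int_iff)

lemma cong_mod_n:
  assumes "d dvd int n"
  shows "[x mod int n = x] (mod d)"
  using assms by (simp add: cong_def mod_mod_cancel)

lemma free_mono: "free G \<Longrightarrow> F \<subseteq> G \<Longrightarrow> free F"
  unfolding free_def by blast

lemma free_iff_independent_image:
  assumes F: "F \<subseteq> C"
  shows "free F \<longleftrightarrow> (\<forall>G \<epsilon>. finite G \<and> G \<subseteq> unity_root n ` F \<and> (\<forall>z\<in>G. \<epsilon> z \<in> A) \<and>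
      (\<Sum>z\<in>G. zscale (\<epsilon> z) z) = 0 \<longrightarrow> (\<forall>z\<in>G. \<epsilon> z = 0))" (is "_ \<longleftrightarrow> ?R")
proof -
  have "inj_on (unity_root n) C"
    by (auto simp: inj_on_def unity_root_eq_iff[OF n_pos] cong_def)
  then have inj: "inj_on (unity_root n) F" using F inj_on_subset by blast
  have finF: "finite F" using F finite_subset by blast
  show ?thesis
  proof
    assume free: "free F"
    show ?R
    proof (intro allI impI)
      fix G \<epsilon>
      assume G: "finite G \<and> G \<subseteq> unity_root n ` F \<and> (\<forall>z\<in>G. \<epsilon> z \<in> A) \<and> (\<Sum>z\<in>G. zscale (\<epsilon> z) z) = 0"
      define H where "H = {x\<in>F. unity_root n x \<in> G}"
      define f where "f x = (if x \<in> H then \<epsilon> (unity_root n x) else 0)" for x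
      have HG: "G = unity_root n ` H" using G by (auto simp: H_def)
      have injH: "inj_on (unity_root n) H" using inj by (rule inj_on_subset) (auto simp: H_def)
      have "(\<Sum>x\<in>C. of_int (f x) * unity_root n x) = (\<Sum>x\<in>H. of_int (\<epsilon> (unity_root n x)) * unity_root n x)"
        using F by (intro sum.mono_neutral_cong_right) (auto simp: H_def f_def)
      also have "\<dots> = (\<Sum>z\<in>G. zscale (\<epsilon> z) z)"
        by (simp add: HG sum.reindex[OF injH] zscale_eq_of_int_mult)
      finally have "vanishing n (\<lambda>x. of_int (f x))" using G by (simp add: vanishing_def)
      moreover have "\<forall>x. f x \<in> A" using G zero_A by (simp add: f_def H_def)
      moreover have "\<forall>x. x \<notin> F \<longrightarrow> f x = 0" by (simp add: f_def H_def)
      ultimately have "\<forall>x. f x = 0" using free unfolding free_def by blast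
      then show "\<forall>z\<in>G. \<epsilon> z = 0" unfolding HG f_def by (metis (no_types, lifting) image_iff)
    qed
  next
    assume R: ?R
    show "free F"
      unfolding free_def
    proof (intro allI impI)
      fix f :: "int \<Rightarrow> int" and x
      assume f: "(\<forall>x. f x \<in> A) \<and> (\<forall>x. x \<notin> F \<longrightarrow> f x = 0) \<and> vanishing n (\<lambda>x. of_int (f x))"
      define \<epsilon> where "\<epsilon> z = f (inv_into F (unity_root n) z)" for z
      have \<epsilon>: "\<epsilon> (unity_root n x) = f x" if "x \<in> F" for x
        using that inj by (simp add: \<epsilon>_def inv_into_f_f)
      have "(\<Sum>z\<in>unity_root n ` F. zscale (\<epsilon> z) z) = (\<Sum>x\<in>F. of_int (f x) * unity_root n x)"
        by (simp add: sum.reindex[OF inj] zscale_eq_of_int_mult \<epsilon>)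
      also have "\<dots> = (\<Sum>x\<in>C. of_int (f x) * unity_root n x)"
        using F f by (intro sum.mono_neutral_left) auto
      also have "\<dots> = 0" using f by (simp add: vanishing_def)
      finally have "(\<Sum>z\<in>unity_root n ` F. zscale (\<epsilon> z) z) = 0" .
      moreover have "\<forall>z\<in>unity_root n ` F. \<epsilon> z \<in> A" using f \<epsilon> by simp
      ultimately have "\<forall>z\<in>unity_root n ` F. \<epsilon> z = 0" using R finF by blast
      then show "f x = 0" using f \<epsilon> by (cases "x \<in> F") auto
    qed
  qed
qed

lemma free_preserving_finite:
  assumes "bij_betw \<sigma> X X" "X \<subseteq> C" "\<And>F. F \<subseteq> X \<Longrightarrow> free F \<Longrightarrow> free (\<sigma> ` F)"
  shows "free_preserving X \<sigma>"
  unfolding free_preserving_def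
  using bij_betw_preserves_iff[of X \<sigma> free] assms finite_subset[OF assms(2)] by auto

text \<open>Pulling back along \<open>\<sigma>\<close> turns a relation supported on \<open>\<sigma> ` F\<close> into one supported on \<open>F\<close>, with the same
  coefficients.\<close>

lemma free_preserving_if_respects:
  assumes \<sigma>: "bij_betw \<sigma> C C" and resp: "respects_prime_cosets n \<sigma>"
  shows "free_preserving C \<sigma>"
proof (rule free_preserving_finite[OF \<sigma> order_refl])
  fix F assume F: "F \<subseteq> C" and free: "free F"
  show "free (\<sigma> ` F)"
    unfolding free_def
  proof (intro allI impI)
    fix f :: "int \<Rightarrow> int" and y
    assume f: "(\<forall>x. f x \<in> A) \<and> (\<forall>x. x \<notin> \<sigma> ` F \<longrightarrow> f x = 0) \<and> vanishing n (\<lambda>x. of_int (f x))"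
    have maps: "\<sigma> \<in> C \<rightarrow> C" using \<sigma> by (auto simp: bij_betw_def)
    define g where "g x = (if x \<in> C then f (\<sigma> x) else 0)" for x
    have "vanishing n (\<lambda>x. of_int (f (\<sigma> x)))"
      using vanishing_comp[OF n2 _ maps resp] f by blast
    then have "vanishing n (\<lambda>x. of_int (g x))"
      by (rule iffD1[OF vanishing_cong, rotated]) (simp add: g_def)
    moreover have "g x = 0" if "x \<notin> F" for x
    proof (cases "x \<in> C")
      case True
      then have "\<sigma> x \<notin> \<sigma> ` F"
        using that F \<sigma> inj_on_image_mem_iff unfolding bij_betw_def by metis
      then show ?thesis using f by (simp add: g_def)
    qed (auto simp: g_def)
    moreover have "\<forall>x. g x \<in> A" using f zero_A by (simp add: g_def)
    ultimately have "\<forall>x. g x = 0" using free unfolding free_def by blast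
    then show "f y = 0"
      using f F by (metis (no_types, lifting) g_def image_iff subsetD)
  qed
qed

text \<open>Here a relation on \<open>\<sigma> ` F\<close> becomes a relation on \<open>F\<close> after changing the signs of those
  coefficients whose root of unity is negated by \<open>\<sigma>\<close>.\<close>

lemma free_preserving_if_signs:
  assumes \<sigma>: "bij_betw \<sigma> C C"
    and sign: "\<And>x. x \<in> C \<Longrightarrow> unity_root n (\<sigma> x) \<in> {unity_root n x, - unity_root n x}"
  shows "free_preserving C \<sigma>"
proof (rule free_preserving_finite[OF \<sigma> order_refl])
  fix F assume F: "F \<subseteq> C" and free: "free F"
  show "free (\<sigma> ` F)"
    unfolding free_def
  proof (intro allI impI)
    fix f :: "int \<Rightarrow> int" and y
    assume f: "(\<forall>x. f x \<in> A) \<and> (\<forall>x. x \<notin> \<sigma> ` F \<longrightarrow> f x = 0) \<and> vanishing n (\<lambda>x. of_int (f x))"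
    define g where "g x = (if x \<in> C then if unity_root n (\<sigma> x) = unity_root n x then f (\<sigma> x)
      else - f (\<sigma> x) else 0)" for x
    have "(\<Sum>x\<in>C. of_int (g x) * unity_root n x) = (\<Sum>x\<in>C. of_int (f (\<sigma> x)) * unity_root n (\<sigma> x))"
      using sign by (intro sum.cong refl) (fastforce simp: g_def)
    also have "\<dots> = (\<Sum>x\<in>C. of_int (f x) * unity_root n x)"
      by (rule sum.reindex_bij_betw[OF \<sigma>])
    finally have "vanishing n (\<lambda>x. of_int (g x))" using f by (simp add: vanishing_def)
    moreover have "g x = 0" if "x \<notin> F" for x
    proof (cases "x \<in> C")
      case True
      then have "\<sigma> x \<notin> \<sigma> ` F"
        using that F \<sigma> inj_on_image_mem_iff unfolding bij_betw_def by metis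
      then show ?thesis using f by (simp add: g_def)
    qed (auto simp: g_def)
    moreover have "\<forall>x. g x \<in> A" using f zero_A minus_A by (simp add: g_def)
    ultimately have "\<forall>x. g x = 0" using free unfolding free_def by blast
    then have zero: "f (\<sigma> x) = 0" if "x \<in> C" for x
      using that unfolding g_def by (metis neg_equal_0_iff_equal)
    show "f y = 0"
    proof (cases "y \<in> \<sigma> ` F")
      case True
      then show ?thesis using zero F by blast
    qed (use f in blast)
  qed
qed

lemma Z2_coset_perm_free_preserving:
  assumes "2 \<in> prime_factors n" "Z2_coset_perm n \<sigma>"
  shows "free_preserving C \<sigma>"
proof (rule free_preserving_if_signs)
  show "bij_betw \<sigma> C C" using assms(2) by (simp add: Z2_coset_perm_def C_carrier permutes_imp_bij)
  fix x assume x: "x \<in> C"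
  have two: "2 dvd n" using assms(1) by auto
  have "x \<in> Zsub n 2 #>\<^bsub>Z n\<^esub> x" using x by (simp add: rcoset_Zsub_iff[OF n_pos two])
  then have "\<sigma> x \<in> Zsub n 2 #>\<^bsub>Z n\<^esub> x" using assms(2) x
    unfolding Z2_coset_perm_def C_carrier by (metis image_subset_iff)
  then have "[\<sigma> x = x] (mod int (n div 2))" by (simp add: rcoset_Zsub_iff[OF n_pos two])
  then show "unity_root n (\<sigma> x) \<in> {unity_root n x, - unity_root n x}"
    using unity_root_minus_half[OF n_pos two] by blast
qed

lemma translation_free_preserving:
  "free_preserving C (\<lambda>x. (t + x) mod int n)"
proof (rule free_preserving_if_respects)
  show "bij_betw (\<lambda>x. (t + x) mod int n) C C"
    by (rule bij_betw_byWitness[of _ "\<lambda>x. (x - t) mod int n"]) (use n_pos in \<open>auto simp: mod_simps\<close>)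
  show "respects_prime_cosets n (\<lambda>x. (t + x) mod int n)"
    unfolding respects_prime_cosets_def
    by (metis cong_add_lcancel cong_mod_n cong_sym cong_trans prime_div(3))
qed

text \<open>The subgroup \<open>Z\<^sub>q\<close> consists of the multiples by \<open>n/q\<close>, so it is mapped into itself by every
  endomorphism, and its cosets are mapped into its cosets.\<close>

lemma automorphism_free_preserving:
  assumes "\<sigma> \<in> iso (Z n) (Z n)"
  shows "free_preserving C \<sigma>"
proof (rule free_preserving_if_respects)
  have hom: "\<sigma> \<in> hom (Z n) (Z n)" and bij: "bij_betw \<sigma> C C"
    using assms by (auto simp: iso_def C_carrier)
  show "bij_betw \<sigma> C C" by fact
  have maps: "\<sigma> x \<in> C" if "x \<in> C" for x using bij that by (auto simp: bij_betw_def)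
  show "respects_prime_cosets n \<sigma>"
    unfolding respects_prime_cosets_def
  proof (intro ballI impI)
    fix q x y assume q: "q \<in> prime_factors n" and xy: "x \<in> C" "y \<in> C" "[x = y] (mod int (n div q))"
    have qd: "q dvd n" using q by auto
    have "x \<in> Zsub n q #>\<^bsub>Z n\<^esub> y" using xy by (simp add: rcoset_Zsub_iff[OF n_pos qd])
    then obtain k where k: "k \<in> C" "x = (k [^]\<^bsub>Z n\<^esub> (n div q)) \<otimes>\<^bsub>Z n\<^esub> y"
      by (auto simp: r_coset_def Zsub_def C_carrier)
    interpret group "Z n" by simp
    have kC: "k [^]\<^bsub>Z n\<^esub> (n div q) \<in> C" using nat_pow_closed k(1) C_carrier by blast
    have "\<sigma> x = \<sigma> (k [^]\<^bsub>Z n\<^esub> (n div q)) \<otimes>\<^bsub>Z n\<^esub> \<sigma> y"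
      using hom_mult[OF hom] kC xy(2) k(2) by (simp only: C_carrier)
    also have "\<sigma> (k [^]\<^bsub>Z n\<^esub> (n div q)) = \<sigma> k [^]\<^bsub>Z n\<^esub> (n div q)"
      using hom_nat_pow[OF hom] k(1) group_integer_mod_group by (simp only: C_carrier)
    finally have "\<sigma> x \<in> Zsub n q #>\<^bsub>Z n\<^esub> \<sigma> y"
      using maps[OF k(1)] unfolding r_coset_def Zsub_def C_carrier by blast
    then show "[\<sigma> x = \<sigma> y] (mod int (n div q))" by (simp add: rcoset_Zsub_iff[OF n_pos qd])
  qed
qed

text \<open>Let \<open>x\<close> and \<open>y\<close> lie in the same coset of \<open>Z\<^sub>q\<close>. As \<open>Z\<^sub>q\<close> is contained in the \<open>q\<close>-primary component,
  \<open>x\<close> and \<open>y\<close> have families of components \<open>u\<close> and \<open>v\<close> that differ only at \<open>q\<close>, and there by an element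
  of \<open>Z\<^sub>q\<close>. If \<open>q \<noteq> p\<close> then \<open>\<sigma>\<close> leaves these components alone; if \<open>q = p\<close> then \<open>\<sigma>'\<close> maps them into a common
  coset of \<open>Z\<^sub>p\<close>.\<close>

lemma primary_component_perm_respects:
  assumes p: "p \<in> prime_factors n" and \<sigma>: "primary_component_perm n p \<sigma>"
  shows "respects_prime_cosets n \<sigma>"
  unfolding respects_prime_cosets_def
proof (intro ballI impI)
  fix q x y assume q: "q \<in> prime_factors n" and xy: "x \<in> C" "y \<in> C" "[x = y] (mod int (n div q))"
  let ?P = "prime_factors n"
  let ?a = "\<lambda>q. q ^ multiplicity q n"
  obtain \<sigma>' where \<sigma>': "\<sigma>' permutes Zsub n (?a p)"
    and cosets: "\<forall>x \<in> Zsub n (?a p).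
        \<exists>y \<in> Zsub n (?a p). \<sigma>' ` (Zsub n p #>\<^bsub>Z n\<^esub> x) \<subseteq> Zsub n p #>\<^bsub>Z n\<^esub> y"
    and act: "\<forall>x \<in> (\<Pi> q\<in>?P. Zsub n (?a q)).
        \<sigma> (\<Otimes>\<^bsub>Z n\<^esub>q\<in>?P. x q) = (\<Otimes>\<^bsub>Z n\<^esub>q\<in>?P. if q = p then \<sigma>' (x q) else x q)"
    using \<sigma> unfolding primary_component_perm_def by (elim conjE exE) (rule that)
  have ad: "?a r dvd n" for r by (rule multiplicity_dvd)
  have adn: "int (n div ?a r) dvd int n" for r
    using ad by (metis dvd_div_mult_self dvd_triv_left int_dvd_int_iff)
  have pdn: "p dvd n" using p by auto
  have Zs: "z \<in> Zsub n (?a r) \<longleftrightarrow> z \<in> C \<and> int (n div ?a r) dvd z" for z r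
    by (rule Zsub_iff[OF n_pos ad])
  have prod: "(\<Prod>r\<in>?P. ?a r) = n"
    using prime_factorization_nat[OF n_pos] by simp
  have "coprime (?a r) (?a s)" if "r \<in> ?P" "s \<in> ?P" "r \<noteq> s" for r s
    using that by (intro coprime_power_left_iff[THEN iffD2] coprime_power_right_iff[THEN iffD2] disjI1)
       (auto intro: primes_coprime)
  then obtain w where w: "\<forall>r\<in>?P. int (n div ?a r) dvd w r" "[x = (\<Sum>r\<in>?P. w r)] (mod int n)"
    using sum_of_coprime_parts[of ?P ?a n x] n_pos by (auto simp: prod)
  define u where "u r = w r mod int n" for r
  define v where "v = u(q := (u q + (y - x)) mod int n)"
  have u: "u \<in> (\<Pi> r\<in>?P. Zsub n (?a r))"
    using w(1) adn by (auto simp: u_def Zs dvd_mod n_pos)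
  have "multiplicity q n > 0" using q by (simp add: prime_factors_multiplicity)
  then have "q dvd ?a q" by (simp add: dvd_power)
  then have "n div ?a q dvd n div q" using div_dvd_div_antimono[OF n_pos _ ad] by blast
  then have "int (n div ?a q) dvd y - x"
    using xy(3) by (meson cong_iff_dvd_diff cong_sym dvd_trans int_dvd_int_iff)
  then have v: "v \<in> (\<Pi> r\<in>?P. Zsub n (?a r))"
    using u adn by (auto simp: v_def Zs dvd_mod n_pos Pi_iff)
  have carr: "f \<in> ?P \<rightarrow> carrier (Z n)" if "f \<in> (\<Pi> r\<in>?P. Zsub n (?a r))" for f
    using that by (auto simp: Zs C_carrier Pi_iff)
  have fin: "finite ?P" by simp
  have "[(\<Sum>r\<in>?P. u r) = (\<Sum>r\<in>?P. w r)] (mod int n)"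
    by (intro cong_sum) (simp add: u_def)
  then have x: "x = (\<Otimes>\<^bsub>Z n\<^esub>r\<in>?P. u r)"
    using finprod_integer_mod_group[OF fin carr[OF u]] w(2) xy(1) by (simp add: cong_def)
  have "[(\<Sum>r\<in>?P. v r) = (\<Sum>r\<in>?P. w r + (if r = q then y - x else 0))] (mod int n)"
    by (intro cong_sum) (simp add: u_def v_def cong_def mod_simps)
  also have "(\<Sum>r\<in>?P. w r + (if r = q then y - x else 0)) = (\<Sum>r\<in>?P. w r) + (y - x)"
    using q by (simp add: sum.distrib)
  also have "[(\<Sum>r\<in>?P. w r) + (y - x) = x + (y - x)] (mod int n)"
    using w(2) by (intro cong_add cong_refl) (rule cong_sym)
  finally have "[(\<Sum>r\<in>?P. v r) = y] (mod int n)" by simp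
  then have y: "y = (\<Otimes>\<^bsub>Z n\<^esub>r\<in>?P. v r)"
    using finprod_integer_mod_group[OF fin carr[OF v]] xy(2) by (simp add: cong_def)
  let ?U = "\<lambda>r. if r = p then \<sigma>' (u r) else u r" and ?V = "\<lambda>r. if r = p then \<sigma>' (v r) else v r"
  have UV: "?U \<in> (\<Pi> r\<in>?P. Zsub n (?a r))" "?V \<in> (\<Pi> r\<in>?P. Zsub n (?a r))"
    using u v permutes_in_image[OF \<sigma>'] by (auto simp: Pi_iff)
  have \<sigma>x: "\<sigma> x = (\<Sum>r\<in>?P. ?U r) mod int n"
    unfolding x bspec[OF act u] by (rule finprod_integer_mod_group[OF fin carr[OF UV(1)]])
  have \<sigma>y: "\<sigma> y = (\<Sum>r\<in>?P. ?V r) mod int n"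
    unfolding y bspec[OF act v] by (rule finprod_integer_mod_group[OF fin carr[OF UV(2)]])
  have uv: "[u q = v q] (mod int (n div q))"
  proof -
    have "[v q = u q + (y - x)] (mod int (n div q))"
      unfolding v_def using cong_mod_n[OF prime_div(3)[OF q]] by simp
    moreover have "[u q + (y - x) = u q + 0] (mod int (n div q))"
      using xy(3) by (intro cong_add cong_refl) (metis cong_diff cong_refl cong_sym diff_self)
    ultimately show ?thesis by (metis add_0_right cong_sym cong_trans)
  qed
  have "[?U r = ?V r] (mod int (n div q))" if "r \<in> ?P" for r
  proof (cases "r = q")
    case False
    then show ?thesis by (simp add: v_def)
  next
    case rq: True
    show ?thesis
    proof (cases "q = p")
      case False
      then show ?thesis using rq uv by simp
    next
      case True
      have "u p \<in> Zsub n (?a p)" "v p \<in> Zsub n (?a p)" using u v p by auto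
      then have "u p \<in> Zsub n p #>\<^bsub>Z n\<^esub> u p" "v p \<in> Zsub n p #>\<^bsub>Z n\<^esub> u p"
        using uv True by (auto simp: rcoset_Zsub_iff[OF n_pos pdn] Zs cong_sym)
      moreover obtain z where "\<sigma>' ` (Zsub n p #>\<^bsub>Z n\<^esub> u p) \<subseteq> Zsub n p #>\<^bsub>Z n\<^esub> z"
        using cosets \<open>u p \<in> Zsub n (?a p)\<close> by blast
      ultimately have "\<sigma>' (u p) \<in> Zsub n p #>\<^bsub>Z n\<^esub> z" "\<sigma>' (v p) \<in> Zsub n p #>\<^bsub>Z n\<^esub> z"
        by (simp_all add: image_subset_iff)
      then have "[\<sigma>' (u p) = z] (mod int (n div p))" "[\<sigma>' (v p) = z] (mod int (n div p))"
        by (auto simp: rcoset_Zsub_iff[OF n_pos pdn])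
      then show ?thesis using rq True by (simp add: cong_def)
    qed
  qed
  then have "[(\<Sum>r\<in>?P. ?U r) = (\<Sum>r\<in>?P. ?V r)] (mod int (n div q))" by (rule cong_sum)
  then show "[\<sigma> x = \<sigma> y] (mod int (n div q))"
    unfolding \<sigma>x \<sigma>y using prime_div(3)[OF q] by (simp add: cong_def mod_mod_cancel)
qed

text \<open>A relation on \<open>\<sigma> ` F\<close> is cut into its part \<open>f1\<close> on \<open>Z\<^bsub>rad n\<^esub>\<close> and its part \<open>f2\<close> outside, where \<open>\<sigma>\<close> is
  the identity; both parts are relations.\<close>

lemma free_preserving_extend:
  assumes \<sigma>: "\<sigma> permutes Zsub n (rad n)" and pres: "free_preserving (Zsub n (rad n)) \<sigma>"
  shows "free_preserving C \<sigma>"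
proof (rule free_preserving_finite[OF _ order_refl])
  let ?S = "Zsub n (rad n)"
  have S: "x \<in> ?S \<longleftrightarrow> x \<in> C \<and> [x = 0] (mod int m)" for x
    using Zsub_iff[OF n_pos rad_dvd[OF n_pos]] by (simp add: cong_0_iff)
  have "?S \<subseteq> C" using S by blast
  then show "bij_betw \<sigma> C C" using \<sigma> by (metis permutes_imp_bij permutes_subset)
  fix F assume F: "F \<subseteq> C" and free: "free F"
  have freeS: "free (\<sigma> ` (F \<inter> ?S))"
    using pres free_mono[OF free, of "F \<inter> ?S"] by (simp add: free_preserving_def)
  show "free (\<sigma> ` F)"
    unfolding free_def
  proof (intro allI impI)
    fix f :: "int \<Rightarrow> int" and y
    assume f: "(\<forall>x. f x \<in> A) \<and> (\<forall>x. x \<notin> \<sigma> ` F \<longrightarrow> f x = 0) \<and> vanishing n (\<lambda>x. of_int (f x))"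
    define f1 where "f1 x = (if [x = 0] (mod int m) then f x else 0)" for x
    define f2 where "f2 x = f x - f1 x" for x
    have v1: "vanishing n (\<lambda>x. of_int (f1 x))"
      unfolding f1_def using f prime_div(2) by (intro vanishing_restrict_class[OF n2]) auto
    then have v2: "vanishing n (\<lambda>x. of_int (f2 x))"
      using f by (simp add: vanishing_def f2_def left_diff_distrib sum_subtractf)
    have \<sigma>F: "\<sigma> ` F \<subseteq> C" using F \<open>bij_betw \<sigma> C C\<close> by (auto simp: bij_betw_def)
    have "f1 x = 0" if "x \<notin> \<sigma> ` (F \<inter> ?S)" for x
    proof (cases "x \<in> \<sigma> ` F")
      case True
      then obtain z where z: "z \<in> F" "x = \<sigma> z" by blast
      then have "x \<notin> ?S" using that permutes_in_image[OF \<sigma>] by blast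
      then show ?thesis using True \<sigma>F by (auto simp: S f1_def)
    next
      case False
      then show ?thesis using f by (simp add: f1_def)
    qed
    moreover have "\<forall>x. f1 x \<in> A" using f zero_A by (simp add: f1_def)
    ultimately have "\<forall>x. f1 x = 0" using freeS v1 unfolding free_def by blast
    moreover have "f2 x = 0" if "x \<notin> F" for x
    proof (cases "x \<in> \<sigma> ` F")
      case True
      then obtain z where "z \<in> F" "x = \<sigma> z" by blast
      then have "z \<in> ?S" using that permutes_not_in[OF \<sigma>, of z] by metis
      then have "x \<in> ?S" using permutes_in_image[OF \<sigma>] \<open>x = \<sigma> z\<close> by blast
      then show ?thesis using S by (simp add: f2_def f1_def)
    next
      case False
      then show ?thesis using f by (simp add: f2_def f1_def)
    qed
    moreover have "\<forall>x. f2 x \<in> A" using f zero_A by (simp add: f2_def f1_def)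
    ultimately have "\<forall>x. f1 x = 0" "\<forall>x. f2 x = 0" using free v2 unfolding free_def by blast+
    then show "f y = 0" by (simp add: f2_def)
  qed
qed

lemma free_preserving_comp:
  assumes "free_preserving X \<sigma>" "free_preserving X \<tau>"
  shows "free_preserving X (\<sigma> \<circ> \<tau>)"
  unfolding free_preserving_def
proof (intro conjI allI impI)
  show "bij_betw (\<sigma> \<circ> \<tau>) X X"
    using assms by (auto simp: free_preserving_def intro: bij_betw_trans)
  fix F assume F: "F \<subseteq> X"
  then have "\<tau> ` F \<subseteq> X" using assms(2) by (auto simp: free_preserving_def bij_betw_def)
  then show "free F \<longleftrightarrow> free ((\<sigma> \<circ> \<tau>) ` F)"
    using assms F unfolding free_preserving_def image_comp[symmetric] by metis
qed

lemma free_preserving_inv: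
  assumes "\<sigma> permutes X" "free_preserving X \<sigma>"
  shows "free_preserving X (Hilbert_Choice.inv \<sigma>)"
  unfolding free_preserving_def
proof (intro conjI allI impI)
  show "bij_betw (Hilbert_Choice.inv \<sigma>) X X" using assms(1) by (simp add: permutes_imp_bij permutes_inv)
  fix F assume "F \<subseteq> X"
  then have "Hilbert_Choice.inv \<sigma> ` F \<subseteq> X" using permutes_in_image[OF permutes_inv[OF assms(1)]] by auto
  moreover have "\<sigma> ` Hilbert_Choice.inv \<sigma> ` F = F"
    using permutes_inverses(1)[OF assms(1)] by (simp add: image_image)
  ultimately show "free F \<longleftrightarrow> free (Hilbert_Choice.inv \<sigma> ` F)" using assms(2) by (metis free_preserving_def)
qed

lemma free_preserving_foldr:
  assumes "\<forall>\<tau>\<in>set \<tau>s. free_preserving X \<tau>"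
  shows "free_preserving X (foldr (\<circ>) \<tau>s id)"
  using assms
proof (induction \<tau>s)
  case Nil
  then show ?case by (simp add: free_preserving_def bij_betw_def)
next
  case (Cons \<tau> \<tau>s)
  then have "free_preserving X (\<tau> \<circ> foldr (\<circ>) \<tau>s id)"
    by (intro free_preserving_comp Cons.IH) auto
  moreover have "foldr (\<circ>) (\<tau> # \<tau>s) id = \<tau> \<circ> foldr (\<circ>) \<tau>s id" by simp
  ultimately show ?case by (simp only:)
qed

section \<open>Preserving permutations respect the cosets of \<open>Z\<^bsub>rad n\<^esub>\<close>\<close>

text \<open>The next two lemmas say that the cosets of \<open>Z\<^sub>q\<close> are minimal dependent sets.\<close>

lemma prime_coset_not_free:
  assumes q: "q \<in> prime_factors n" and c: "c \<in> C"
  shows "\<not> free {x \<in> C. [x = c] (mod int (n div q))}"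
proof
  let ?K = "{x \<in> C. [x = c] (mod int (n div q))}"
  define f :: "int \<Rightarrow> int" where "f x = (if x \<in> ?K then 1 else 0)" for x
  assume "free ?K"
  moreover have "vanishing n (\<lambda>x. if [x = c] (mod int (n div q)) then 1 else 0)"
    by (rule vanishing_periodic[OF n_pos q]) (auto simp: periodic_def cong_def)
  then have "vanishing n (\<lambda>x. of_int (f x))"
    by (rule iffD1[OF vanishing_cong, rotated]) (simp add: f_def)
  moreover have "\<forall>x. f x \<in> A" "\<forall>x. x \<notin> ?K \<longrightarrow> f x = 0"
    using zero_A one_A by (simp_all add: f_def)
  ultimately have "f c = 0" unfolding free_def by blast
  then show False using c by (simp add: f_def)
qed

text \<open>Up to the factor \<open>\<omega>\<^sup>c\<close>, a relation on the coset \<open>c + Z\<^sub>q\<close> is a relation between the \<open>q\<close>-th roots of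
  unity. Its coefficients are therefore all equal, so they vanish when one of them does.\<close>

lemma prime_coset_proper_subset_free:
  assumes q: "q \<in> prime_factors n"
    and G: "G \<subset> {x \<in> C. [x = c] (mod int (n div q))}"
  shows "free G"
  unfolding free_def
proof (intro allI impI)
  let ?t = "int (n div q)" and ?K = "{x \<in> C. [x = c] (mod int (n div q))}"
  fix f :: "int \<Rightarrow> int" and x
  assume f: "(\<forall>x. f x \<in> A) \<and> (\<forall>x. x \<notin> G \<longrightarrow> f x = 0) \<and> vanishing n (\<lambda>x. of_int (f x))"
  define \<phi> where "\<phi> j = (c + ?t * j) mod int n" for j
  note qf = prime_div[OF q]
  have nt: "int n = ?t * int q" using qf(4) by (metis mult.commute of_nat_mult)
  have q0: "q > 0" using qf(5) by (simp add: prime_gt_0_nat)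
  have "n div q \<noteq> 0" using qf(4) n_pos by (metis mult_0_right less_irrefl)
  then have t0: "?t > 0" by simp
  have bij: "bij_betw \<phi> {0..<int q} ?K"
    unfolding bij_betw_def
  proof (intro conjI inj_onI subset_antisym subsetI)
    fix i j assume ij: "i \<in> {0..<int q}" "j \<in> {0..<int q}" "\<phi> i = \<phi> j"
    then have "[c + ?t * i = c + ?t * j] (mod int n)" by (simp add: \<phi>_def cong_def)
    then have "[?t * i = ?t * j] (mod ?t * int q)" by (simp only: cong_add_lcancel nt)
    then have "?t * int q dvd ?t * (i - j)" by (simp add: cong_iff_dvd_diff right_diff_distrib)
    then have "[i = j] (mod int q)" using t0 by (simp add: cong_iff_dvd_diff)
    then show "i = j" using ij by (simp add: cong_def)
  next
    fix y assume "y \<in> \<phi> ` {0..<int q}"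
    then obtain j where y: "y = \<phi> j" by blast
    have "[\<phi> j = c + ?t * j] (mod ?t)" unfolding \<phi>_def by (rule cong_mod_n[OF qf(3)])
    also have "[c + ?t * j = c] (mod ?t)" by (simp add: cong_iff_dvd_diff)
    finally show "y \<in> ?K" using n_pos by (simp add: y \<phi>_def)
  next
    fix y assume y: "y \<in> ?K"
    then have "?t dvd y - c" by (simp add: cong_iff_dvd_diff)
    then obtain k where k: "y - c = ?t * k" by blast
    have "[?t * (k mod int q) = ?t * k] (mod int n)"
      unfolding nt by (simp add: cong_def mod_simps flip: mult_mod_right)
    then have "[c + ?t * (k mod int q) = c + ?t * k] (mod int n)" by (intro cong_add cong_refl)
    then have "\<phi> (k mod int q) = (c + (y - c)) mod int n" unfolding k \<phi>_def cong_def .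
    then have "y = \<phi> (k mod int q)" using y by simp
    then show "y \<in> \<phi> ` {0..<int q}" using q0 by (intro image_eqI) auto
  qed
  have "unity_root n (?t * j) = unity_root q j" for j
  proof -
    define t where "t = real (n div q)"
    have "real n = t * real q" unfolding t_def using qf(4) by (metis mult.commute of_nat_mult)
    moreover have "real_of_int (?t * j) = t * real_of_int j" by (simp add: t_def)
    moreover have "t \<noteq> 0" using \<open>n div q \<noteq> 0\<close> by (simp only: t_def of_nat_eq_0_iff not_False_eq_True)
    ultimately have "2 * pi * real_of_int (?t * j) / real n = 2 * pi * real_of_int j / real q"
      by (simp only:) (simp add: mult.left_commute)
    then show ?thesis by (simp only: unity_root_def)
  qed
  then have ur: "unity_root n (\<phi> j) = unity_root n c * unity_root q j" for j
    unfolding \<phi>_def using n_pos by (simp add: unity_root_add)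
  have supp: "f y = 0" if "y \<notin> ?K" for y using f G that by blast
  have "(\<Sum>y\<in>C. of_int (f y) * unity_root n y) = (\<Sum>y\<in>?K. of_int (f y) * unity_root n y)"
    using supp by (intro sum.mono_neutral_right) auto
  also have "\<dots> = (\<Sum>j\<in>{0..<int q}. of_int (f (\<phi> j)) * unity_root n (\<phi> j))"
    by (rule sum.reindex_bij_betw[OF bij, symmetric])
  also have "\<dots> = unity_root n c * (\<Sum>j\<in>{0..<int q}. of_int (f (\<phi> j)) * unity_root q j)"
    by (simp add: ur sum_distrib_left mult_ac)
  finally have "vanishing q (\<lambda>j. of_int (f (\<phi> j)))"
    using f by (simp add: vanishing_def)
  then have const: "f (\<phi> i) = f (\<phi> j)" if "i \<in> {0..<int q}" "j \<in> {0..<int q}" for i j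
    using vanishing_prime_const[OF qf(5), of "\<lambda>j. f (\<phi> j)"] that by blast
  obtain y where y: "y \<in> ?K" "y \<notin> G" using G by blast
  have img: "z \<in> \<phi> ` {0..<int q}" if "z \<in> ?K" for z
    using bij that by (simp only: bij_betw_def)
  show "f x = 0"
  proof (cases "x \<in> ?K")
    case True
    obtain i where i: "i \<in> {0..<int q}" "x = \<phi> i" using img[OF True] by (rule imageE)
    obtain j where j: "j \<in> {0..<int q}" "y = \<phi> j" using img[OF y(1)] by (rule imageE)
    have "f x = f y" unfolding i(2) j(2) by (rule const[OF i(1) j(1)])
    also have "f y = 0" using f y(2) by blast
    finally show ?thesis .
  qed (rule supp)
qed

text \<open>The image of a coset of \<open>Z\<^sub>q\<close> is again a minimal dependent set. If it met two classes modulo \<open>m\<close>,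
  one of the parts into which its relation is cut would be nonzero and have smaller support.\<close>

lemma preserving_cong_step:
  assumes \<sigma>: "free_preserving C \<sigma>" and q: "q \<in> prime_factors n"
    and xy: "x \<in> C" "y \<in> C" "[x = y] (mod int (n div q))"
  shows "[\<sigma> x = \<sigma> y] (mod int m)"
proof (rule ccontr)
  assume neq: "\<not> [\<sigma> x = \<sigma> y] (mod int m)"
  let ?K = "{z \<in> C. [z = y] (mod int (n div q))}"
  have K: "x \<in> ?K" "y \<in> ?K" using xy by auto
  have bij: "bij_betw \<sigma> C C" using \<sigma> by (simp add: free_preserving_def)
  have "?K \<subseteq> C" by blast
  then have "\<not> free (\<sigma> ` ?K)"
    using \<sigma> prime_coset_not_free[OF q xy(2)] unfolding free_preserving_def by blast
  then obtain f :: "int \<Rightarrow> int" where f: "\<forall>z. f z \<in> A" "\<forall>z. z \<notin> \<sigma> ` ?K \<longrightarrow> f z = 0"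
      "vanishing n (\<lambda>z. of_int (f z))" "\<exists>z. f z \<noteq> 0"
    unfolding free_def by (auto simp only: not_all not_imp)
  \<comment> \<open>No nonzero relation can live on \<open>\<sigma> ` ?K\<close> and miss the image of some \<open>z \<in> ?K\<close>.\<close>
  have small: "\<forall>w. g w = 0" if g: "\<forall>w. g w \<in> A" "vanishing n (\<lambda>w. of_int (g w))"
      "\<forall>w. w \<notin> \<sigma> ` ?K \<longrightarrow> g w = 0" and z: "z \<in> ?K" "g (\<sigma> z) = 0" for g z
  proof -
    have "free (?K - {z})" using z(1) by (intro prime_coset_proper_subset_free[OF q, of _ y]) blast
    then have "free (\<sigma> ` (?K - {z}))"
      using \<sigma> unfolding free_preserving_def by (auto simp: subset_iff)
    moreover have "g w = 0" if "w \<notin> \<sigma> ` (?K - {z})" for w using that g(3) z(2) by blast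
    ultimately show ?thesis using g unfolding free_def by blast
  qed
  define f1 where "f1 w = (if [w = \<sigma> x] (mod int m) then f w else 0)" for w
  have v1: "vanishing n (\<lambda>w. of_int (f1 w))"
    unfolding f1_def using f(3) prime_div(2) by (intro vanishing_restrict_class[OF n2])
  have y0: "f1 (\<sigma> y) = 0" using neq by (simp add: f1_def cong_sym_eq)
  have A1: "\<forall>w. f1 w \<in> A" using f(1) zero_A by (simp add: f1_def)
  have S1: "\<forall>w. w \<notin> \<sigma> ` ?K \<longrightarrow> f1 w = 0" unfolding f1_def using f(2) by presburger
  have "\<forall>w. f1 w = 0" by (rule small[OF A1 v1 S1 K(2) y0])
  then have "f (\<sigma> x) = 0" by (metis cong_refl f1_def)
  then have "\<forall>w. f w = 0" by (rule small[OF f(1,3,2) K(1)])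
  then show False using f(4) by blast
qed

text \<open>Any two elements of a coset of \<open>Z\<^bsub>rad n\<^esub>\<close> are joined by a chain of steps within cosets of the
  \<open>Z\<^sub>q\<close>.\<close>

lemma preserving_cong:
  assumes \<sigma>: "free_preserving C \<sigma>" and xy: "x \<in> C" "y \<in> C" "[x = y] (mod int m)"
  shows "[\<sigma> x = \<sigma> y] (mod int m)"
proof -
  have "coprime q r" if "q \<in> prime_factors n" "r \<in> prime_factors n" "q \<noteq> r" for q r
    using that by (auto intro: primes_coprime)
  moreover have "int m dvd y - x" using xy(3) by (metis cong_iff_dvd_diff cong_sym)
  ultimately obtain w where w: "\<forall>q\<in>prime_factors n. int (n div q) dvd w q"
    "[y - x = (\<Sum>q\<in>prime_factors n. w q)] (mod int n)"
    using sum_of_coprime_parts[of "prime_factors n" "\<lambda>q. q" n "y - x"] rad_dvd[OF n_pos] n_pos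
    by (auto simp: rad_def)
  have "[\<sigma> ((x + (\<Sum>q\<in>P. w q)) mod int n) = \<sigma> x] (mod int m)" if "finite P" "P \<subseteq> prime_factors n" for P
    using that
  proof (induction P rule: finite_induct)
    case empty
    then show ?case using xy(1) by simp
  next
    case (insert q P)
    let ?a = "x + (\<Sum>q\<in>P. w q)"
    have q: "q \<in> prime_factors n" using insert.prems by simp
    have "[?a + w q = ?a] (mod int (n div q))" using w(1) q by (simp add: cong_iff_dvd_diff)
    then have "[(?a + w q) mod int n = ?a mod int n] (mod int (n div q))"
      using cong_mod_n[OF prime_div(3)[OF q]] by (metis cong_sym cong_trans)
    then have "[\<sigma> ((?a + w q) mod int n) = \<sigma> (?a mod int n)] (mod int m)"
      by (intro preserving_cong_step[OF \<sigma> q] mod_in_C)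
    also have "[\<sigma> (?a mod int n) = \<sigma> x] (mod int m)" using insert by simp
    finally show ?case using insert.hyps by (simp add: add_ac)
  qed
  moreover have "(x + (\<Sum>q\<in>prime_factors n. w q)) mod int n = y"
  proof -
    have "[x + (y - x) = x + (\<Sum>q\<in>prime_factors n. w q)] (mod int n)"
      using w(2) by (intro cong_add cong_refl)
    then show ?thesis using xy(2) by (simp add: cong_def)
  qed
  ultimately show ?thesis by (metis cong_sym finite_set_mset order_refl)
qed

end

section \<open>Decomposition of preserving permutations\<close>

locale root_of_unity_coset_reps = root_of_unity_relations +
  fixes E :: "int set"
  assumes E_sub: "E \<subseteq> {0..<int n}" and E_ex1: "\<And>x. \<exists>!e. e \<in> E \<and> [e = x] (mod int (n div rad n))"
begin

definition rep :: "int \<Rightarrow> int" where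
  "rep x = (THE e. e \<in> E \<and> [e = x] (mod int m))"

lemma rep: "rep x \<in> E" "[rep x = x] (mod int m)"
  using theI'[OF E_ex1[of x]] by (simp_all add: rep_def)

lemma rep_unique: "e \<in> E \<Longrightarrow> [e = x] (mod int m) \<Longrightarrow> rep x = e"
  using E_ex1[of x] rep[of x] by blast

lemma rep_eq_iff: "rep x = rep y \<longleftrightarrow> [x = y] (mod int m)"
  using rep rep_unique by (metis cong_sym cong_trans)

lemma rep_id [simp]: "e \<in> E \<Longrightarrow> rep e = e"
  by (simp add: rep_unique)

lemma S_iff: "x \<in> Zsub n (rad n) \<longleftrightarrow> x \<in> C \<and> rep x = rep 0"
  by (simp add: Zsub_iff[OF n_pos rad_dvd[OF n_pos]] rep_eq_iff cong_0_iff)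

text \<open>On each coset of \<open>Z\<^bsub>rad n\<^esub>\<close>, the permutation \<open>\<sigma>\<close> is a translation, and a coset of \<open>Z\<^sub>q\<close> lies in one
  coset of \<open>Z\<^bsub>rad n\<^esub>\<close>.\<close>

lemma reps_perm_respects:
  assumes "reps_perm n E \<sigma>"
  shows "respects_prime_cosets n \<sigma>"
proof -
  obtain \<sigma>' where \<sigma>': "\<sigma>' permutes E"
    and act: "\<forall>x\<in>Zsub n (rad n). \<forall>y\<in>E. \<sigma> (x \<otimes>\<^bsub>Z n\<^esub> y) = x \<otimes>\<^bsub>Z n\<^esub> \<sigma>' y"
    using assms unfolding reps_perm_def by blast
  have \<sigma>: "[\<sigma> x = x - rep x + \<sigma>' (rep x)] (mod int n)" if x: "x \<in> C" for x
  proof -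
    have "int m dvd x - rep x" using rep(2)[of x] by (metis cong_iff_dvd_diff cong_sym)
    then have "(x - rep x) mod int n \<in> Zsub n (rad n)"
      using m_dvd_n by (simp add: Zsub_iff[OF n_pos rad_dvd[OF n_pos]] dvd_mod n_pos)
    then have "\<sigma> ((x - rep x) mod int n \<otimes>\<^bsub>Z n\<^esub> rep x) = (x - rep x) mod int n \<otimes>\<^bsub>Z n\<^esub> \<sigma>' (rep x)"
      using act rep(1) by blast
    then show ?thesis using x by (simp add: cong_def mod_simps)
  qed
  show ?thesis
    unfolding respects_prime_cosets_def
  proof (intro ballI impI)
    fix q x y assume q: "q \<in> prime_factors n" and xy: "x \<in> C" "y \<in> C" "[x = y] (mod int (n div q))"
    note qn = prime_div[OF q]
    have "rep x = rep y" using xy(3) qn(2) unfolding rep_eq_iff by (meson cong_dvd_modulus int_dvd_int_iff)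
    have "[\<sigma> x = x - rep x + \<sigma>' (rep x)] (mod int (n div q))"
      using \<sigma>[OF xy(1)] qn(3) by (rule cong_dvd_modulus)
    also have "[x - rep x + \<sigma>' (rep x) = y - rep y + \<sigma>' (rep y)] (mod int (n div q))"
      unfolding \<open>rep x = rep y\<close> using xy(3) by (intro cong_add cong_diff cong_refl)
    also have "[y - rep y + \<sigma>' (rep y) = \<sigma> y] (mod int (n div q))"
      using cong_dvd_modulus[OF \<sigma>[OF xy(2)] qn(3)] by (rule cong_sym)
    finally show "[\<sigma> x = \<sigma> y] (mod int (n div q))" .
  qed
qed

lemma reps_perm_free_preserving:
  assumes "reps_perm n E \<sigma>"
  shows "free_preserving C \<sigma>"
proof (rule free_preserving_if_respects)
  show "bij_betw \<sigma> C C" using assms by (simp add: reps_perm_def C_carrier permutes_imp_bij)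
qed (rule reps_perm_respects[OF assms])

text \<open>The permutation \<open>x + y \<mapsto> x + \<pi> y\<close> for \<open>x \<in> Z\<^bsub>rad n\<^esub>\<close>, \<open>y \<in> E\<close>, extended by the identity outside the
  carrier as \<^const>\<open>permutes\<close> demands.\<close>

definition move_reps :: "(int \<Rightarrow> int) \<Rightarrow> int \<Rightarrow> int" where
  "move_reps \<pi> x = (if x \<in> C then (x - rep x + \<pi> (rep x)) mod int n else x)"

lemma move_reps_in_C: "x \<in> C \<Longrightarrow> move_reps \<pi> x \<in> C"
  using n_pos by (simp add: move_reps_def)

lemma rep_move_reps:
  assumes "\<pi> permutes E" "x \<in> C"
  shows "rep (move_reps \<pi> x) = \<pi> (rep x)"
proof (rule rep_unique)
  show "\<pi> (rep x) \<in> E" using assms(1) rep(1) by (simp add: permutes_in_image)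
  have "[x - rep x + \<pi> (rep x) = 0 + \<pi> (rep x)] (mod int m)"
    using rep(2)[of x] by (intro cong_add cong_refl) (metis cong_diff_iff_cong_0 cong_sym)
  moreover have "[move_reps \<pi> x = x - rep x + \<pi> (rep x)] (mod int m)"
    using assms(2) cong_mod_n[OF m_dvd_n] by (simp add: move_reps_def)
  ultimately show "[\<pi> (rep x) = move_reps \<pi> x] (mod int m)"
    by (metis add_0 cong_sym cong_trans)
qed

lemma move_reps_comp:
  assumes "\<pi> permutes E" "\<pi>' permutes E"
  shows "move_reps \<pi> (move_reps \<pi>' x) = move_reps (\<pi> \<circ> \<pi>') x"
proof (cases "x \<in> C")
  case True
  have "move_reps \<pi> (move_reps \<pi>' x)
      = (move_reps \<pi>' x - \<pi>' (rep x) + \<pi> (\<pi>' (rep x))) mod int n"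
    using move_reps_in_C[OF True] rep_move_reps[OF assms(2) True] by (simp add: move_reps_def)
  also have "\<dots> = (x - rep x + \<pi>' (rep x) - \<pi>' (rep x) + \<pi> (\<pi>' (rep x))) mod int n"
  proof -
    have "[move_reps \<pi>' x = x - rep x + \<pi>' (rep x)] (mod int n)"
      using True by (simp add: move_reps_def cong_def)
    then show ?thesis
      unfolding cong_def[symmetric] by (intro cong_add cong_diff cong_refl)
  qed
  finally show ?thesis using True by (simp add: move_reps_def)
qed (auto simp: move_reps_def)

lemma move_reps_id: "move_reps id x = x"
  by (simp add: move_reps_def)

lemma move_reps_permutes:
  assumes "\<pi> permutes E"
  shows "move_reps \<pi> permutes C"
proof -
  have inv: "Hilbert_Choice.inv \<pi> permutes E" using assms by (rule permutes_inv)
  have "bij_betw (move_reps \<pi>) C C"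
    using move_reps_comp[OF assms inv] move_reps_comp[OF inv assms] permutes_inv_o[OF assms]
    by (intro bij_betw_byWitness[where f' = "move_reps (Hilbert_Choice.inv \<pi>)"])
      (auto simp: move_reps_id intro!: move_reps_in_C simp del: atLeastLessThan_iff)
  then show ?thesis by (rule bij_imp_permutes) (auto simp: move_reps_def)
qed

lemma reps_perm_move_reps:
  assumes "\<pi> permutes E"
  shows "reps_perm n E (move_reps \<pi>)"
  unfolding reps_perm_def C_carrier
proof (intro conjI exI ballI)
  show "move_reps \<pi> permutes C" by (rule move_reps_permutes[OF assms])
  show "\<pi> permutes E" by fact
  fix x y assume xy: "x \<in> Zsub n (rad n)" "y \<in> E"
  have "[(x + y) mod int n = x + y] (mod int m)" by (rule cong_mod_n[OF m_dvd_n])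
  moreover have "[x + y = y] (mod int m)"
    using xy(1) by (simp add: Zsub_iff[OF n_pos rad_dvd[OF n_pos]] cong_iff_dvd_diff)
  ultimately have "[y = (x + y) mod int n] (mod int m)" by (metis cong_sym cong_trans)
  then have "rep ((x + y) mod int n) = y" using rep_unique xy(2) by blast
  then have "move_reps \<pi> ((x + y) mod int n) = ((x + y) mod int n - y + \<pi> y) mod int n"
    using n_pos by (simp add: move_reps_def)
  also have "\<dots> = (x + y - y + \<pi> y) mod int n"
    unfolding cong_def[symmetric] by (intro cong_add cong_diff cong_refl) (simp add: cong_def)
  finally show "move_reps \<pi> (x \<otimes>\<^bsub>Z n\<^esub> y) = x \<otimes>\<^bsub>Z n\<^esub> \<pi> y" by simp
qed

text \<open>The factors into which \<open>generated_preserving\<close> decomposes a preserving permutation.\<close>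

abbreviation basic_perm :: "(int \<Rightarrow> int) \<Rightarrow> bool" where
  "basic_perm \<tau> \<equiv> reps_perm n E \<tau> \<or>
     \<tau> permutes Zsub n (rad n) \<and> free_preserving (Zsub n (rad n)) \<tau>"

definition generated :: "(int \<Rightarrow> int) \<Rightarrow> bool" where
  "generated \<sigma> \<longleftrightarrow> (\<exists>\<tau>s. (\<forall>\<tau>\<in>set \<tau>s. basic_perm \<tau>) \<and> \<sigma> = foldr (\<circ>) \<tau>s id)"

lemma foldr_comp_append: "foldr (\<circ>) (xs @ ys) id = foldr (\<circ>) xs id \<circ> foldr (\<circ>) ys id"
  by (induction xs) (simp_all add: comp_assoc)

lemma generated_comp: "generated \<sigma> \<Longrightarrow> generated \<tau> \<Longrightarrow> generated (\<sigma> \<circ> \<tau>)"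
  unfolding generated_def
proof (elim exE conjE)
  fix xs ys
  assume "\<forall>\<tau>\<in>set xs. basic_perm \<tau>" "\<forall>\<tau>\<in>set ys. basic_perm \<tau>"
    "\<sigma> = foldr (\<circ>) xs id" "\<tau> = foldr (\<circ>) ys id"
  then show "\<exists>\<tau>s. (\<forall>\<tau>\<in>set \<tau>s. basic_perm \<tau>) \<and> \<sigma> \<circ> \<tau> = foldr (\<circ>) \<tau>s id"
    by (intro exI[of _ "xs @ ys"]) (auto simp only: foldr_comp_append set_append Un_iff)
qed

lemma generated_basic_perm: "basic_perm \<sigma> \<Longrightarrow> generated \<sigma>"
  unfolding generated_def by (intro exI[of _ "[\<sigma>]"]) simp

lemma generated_id: "generated id"
  unfolding generated_def by (intro exI[of _ "[]"]) simp

text \<open>The part of \<open>\<rho>\<close> acting on the coset of \<open>e\<close> is \<open>\<tau> \<circ> \<kappa> \<circ> \<tau>\<close>, where \<open>\<tau>\<close> exchanges this coset with \<open>Z\<^bsub>rad n\<^esub>\<close>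
  (whose representative is \<open>rep 0\<close>) and \<open>\<kappa>\<close> acts on \<open>Z\<^bsub>rad n\<^esub>\<close> only. On subsets of \<open>Z\<^bsub>rad n\<^esub>\<close>, \<open>\<kappa>\<close> agrees with
  \<open>\<tau> \<circ> \<rho> \<circ> \<tau>\<close>, which preserves the free sets.\<close>

lemma generated_single_coset:
  assumes \<rho>: "\<rho> permutes C" "free_preserving C \<rho>" and rep_\<rho>: "\<And>x. x \<in> C \<Longrightarrow> rep (\<rho> x) = rep x"
    and e: "e \<in> E"
  shows "generated (\<lambda>x. if x \<in> C \<and> rep x = e then \<rho> x else x)" (is "generated ?\<rho>e")
proof -
  let ?S = "Zsub n (rad n)" and ?\<pi> = "transpose e (rep 0)"
  define \<tau> where "\<tau> = move_reps ?\<pi>"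
  define \<kappa> where "\<kappa> = \<tau> \<circ> ?\<rho>e \<circ> \<tau>"
  have \<pi>: "?\<pi> permutes E" using e rep(1) by (rule permutes_swap_id)
  have \<tau>: "reps_perm n E \<tau>" "\<tau> permutes C" "free_preserving C \<tau>"
    unfolding \<tau>_def using reps_perm_move_reps[OF \<pi>] move_reps_permutes[OF \<pi>]
      reps_perm_free_preserving by blast+
  have \<tau>\<tau>: "\<tau> (\<tau> x) = x" for x
    using move_reps_comp[OF \<pi> \<pi>] by (simp add: \<tau>_def move_reps_id)
  have rep_\<tau>: "rep (\<tau> x) = ?\<pi> (rep x)" if "x \<in> C" for x
    unfolding \<tau>_def by (rule rep_move_reps[OF \<pi> that])
  have \<tau>C: "\<tau> x \<in> C \<longleftrightarrow> x \<in> C" for x by (rule permutes_in_image[OF \<tau>(2)])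
  have \<rho>C: "\<rho> x \<in> C \<longleftrightarrow> x \<in> C" for x by (rule permutes_in_image[OF \<rho>(1)])
  have inj\<rho>: "inj \<rho>" using \<rho>(1) by (rule permutes_inj)
  have inj: "inj_on ?\<rho>e C"
  proof (rule inj_onI)
    fix x y assume xy: "x \<in> C" "y \<in> C" "?\<rho>e x = ?\<rho>e y"
    then have "rep (?\<rho>e x) = rep (?\<rho>e y)" by simp
    then have "rep x = rep y" using xy(1,2) rep_\<rho> by (simp split: if_splits)
    then show "x = y" using xy inj\<rho> by (auto split: if_splits dest: injD)
  qed
  have "?\<rho>e ` C \<subseteq> C"
    using \<rho>C by (intro image_subsetI) (simp del: atLeastLessThan_iff)
  then have "?\<rho>e ` C = C" using endo_inj_surj[OF _ _ inj] by blast
  with inj have "bij_betw ?\<rho>e C C" by (simp only: bij_betw_def)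
  then have "?\<rho>e permutes C" by (rule bij_imp_permutes) auto
  then have \<kappa>C: "\<kappa> permutes C" unfolding \<kappa>_def by (intro permutes_compose \<tau>(2))
  have \<kappa>: "\<kappa> permutes ?S"
  proof (rule permutes_superset[OF \<kappa>C])
    fix x assume x: "x \<in> C - ?S"
    then have "rep x \<noteq> rep 0" by (simp add: S_iff)
    then have "rep (\<tau> x) \<noteq> e" using rep_\<tau>[of x] x by (auto simp: transpose_def)
    then show "\<kappa> x = x" by (simp add: \<kappa>_def \<tau>\<tau>)
  qed
  have "free_preserving ?S \<kappa>"
    unfolding free_preserving_def
  proof (intro conjI allI impI)
    show "bij_betw \<kappa> ?S ?S" using \<kappa> by (rule permutes_imp_bij)
    fix F assume F: "F \<subseteq> ?S"
    have "?\<rho>e (\<tau> x) = \<rho> (\<tau> x)" if "x \<in> F" for x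
      using that F rep_\<tau>[of x] \<tau>C[of x] by (auto simp: S_iff subset_iff)
    then have "\<kappa> ` F = (\<tau> \<circ> (\<rho> \<circ> \<tau>)) ` F"
      unfolding \<kappa>_def by (intro image_cong refl) (simp only: comp_apply)
    moreover have "free_preserving C (\<tau> \<circ> (\<rho> \<circ> \<tau>))"
      by (intro free_preserving_comp \<tau>(3) \<rho>(2))
    moreover have "F \<subseteq> C" using F S_iff by blast
    ultimately show "free F \<longleftrightarrow> free (\<kappa> ` F)" by (simp only: free_preserving_def)
  qed
  then have "generated (\<tau> \<circ> (\<kappa> \<circ> \<tau>))"
    using \<kappa> \<tau>(1) by (intro generated_comp generated_basic_perm) simp_all
  moreover have "\<tau> \<circ> (\<kappa> \<circ> \<tau>) = ?\<rho>e" unfolding \<kappa>_def by (rule ext) (simp add: \<tau>\<tau>)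
  ultimately show ?thesis by simp
qed

lemma generated_coset_fixing:
  assumes \<rho>: "\<rho> permutes C" "free_preserving C \<rho>" and rep_\<rho>: "\<And>x. x \<in> C \<Longrightarrow> rep (\<rho> x) = rep x"
  shows "generated \<rho>"
proof -
  have finE: "finite E" using E_sub finite_subset by blast
  have "generated (\<lambda>x. if x \<in> C \<and> rep x \<in> L then \<rho> x else x)" if "finite L" "L \<subseteq> E" for L
    using that
  proof (induction L rule: finite_induct)
    case empty
    then show ?case using generated_id by (simp add: id_def)
  next
    case (insert e L)
    let ?\<rho>e = "\<lambda>x. if x \<in> C \<and> rep x = e then \<rho> x else x"
      and ?\<rho>L = "\<lambda>x. if x \<in> C \<and> rep x \<in> L then \<rho> x else x"
    have "generated (?\<rho>e \<circ> ?\<rho>L)"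
      using insert by (intro generated_comp generated_single_coset[OF \<rho> rep_\<rho>]) auto
    moreover have "?\<rho>e \<circ> ?\<rho>L = (\<lambda>x. if x \<in> C \<and> rep x \<in> insert e L then \<rho> x else x)"
      using insert.hyps(2) rep_\<rho> by (intro ext) auto
    ultimately show ?case by simp
  qed
  from this[OF finE order_refl] have "generated (\<lambda>x. if x \<in> C then \<rho> x else x)"
    by (simp add: rep)
  moreover have "(\<lambda>x. if x \<in> C then \<rho> x else x) = \<rho>"
    using permutes_not_in[OF \<rho>(1)] by auto
  ultimately show ?thesis by simp
qed

text \<open>Both \<open>\<sigma>\<close> and its inverse respect congruence modulo \<open>m\<close>, so \<open>\<sigma>\<close> induces a permutation \<open>\<pi>\<close> of \<open>E\<close>.
  Composing \<open>\<sigma>\<close> with the inverse of \<open>move_reps \<pi>\<close> gives a permutation \<open>\<rho>\<close> that maps each coset to itself.\<close>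

lemma generated_preserving:
  assumes \<sigma>: "\<sigma> permutes C" "free_preserving C \<sigma>"
  shows "generated \<sigma>"
proof -
  have rep_\<sigma>: "rep (\<sigma> x) = rep (\<sigma> y) \<longleftrightarrow> rep x = rep y" if "x \<in> C" "y \<in> C" for x y
  proof
    assume "rep x = rep y"
    then show "rep (\<sigma> x) = rep (\<sigma> y)"
      using preserving_cong[OF \<sigma>(2) that] by (simp add: rep_eq_iff)
  next
    assume "rep (\<sigma> x) = rep (\<sigma> y)"
    moreover have "\<sigma> x \<in> C" "\<sigma> y \<in> C" using that permutes_in_image[OF \<sigma>(1)] by blast+
    ultimately have "[Hilbert_Choice.inv \<sigma> (\<sigma> x) = Hilbert_Choice.inv \<sigma> (\<sigma> y)] (mod int m)"
      using preserving_cong[OF free_preserving_inv[OF \<sigma>]] by (simp add: rep_eq_iff)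
    then show "rep x = rep y" using permutes_inverses(2)[OF \<sigma>(1)] by (simp add: rep_eq_iff)
  qed
  have EC: "e \<in> C" if "e \<in> E" for e using that E_sub by blast
  have finE: "finite E" using E_sub finite_subset by blast
  define \<pi> where "\<pi> e = (if e \<in> E then rep (\<sigma> e) else e)" for e
  have "inj_on \<pi> E"
  proof (rule inj_onI)
    fix d e assume de: "d \<in> E" "e \<in> E" "\<pi> d = \<pi> e"
    then have "rep d = rep e" using rep_\<sigma> EC by (simp add: \<pi>_def)
    then show "d = e" using de by simp
  qed
  moreover have "\<pi> ` E \<subseteq> E" by (auto simp: \<pi>_def rep)
  ultimately have "bij_betw \<pi> E E" using finE by (simp add: bij_betw_def endo_inj_surj)
  then have \<pi>: "\<pi> permutes E" by (rule bij_imp_permutes) (simp add: \<pi>_def)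
  then have \<pi>i: "Hilbert_Choice.inv \<pi> permutes E" by (rule permutes_inv)
  define \<rho> where "\<rho> = move_reps (Hilbert_Choice.inv \<pi>) \<circ> \<sigma>"
  have "generated \<rho>"
  proof (rule generated_coset_fixing)
    show "\<rho> permutes C" unfolding \<rho>_def by (intro permutes_compose \<sigma>(1) move_reps_permutes[OF \<pi>i])
    show "free_preserving C \<rho>"
      unfolding \<rho>_def
      by (intro free_preserving_comp \<sigma>(2) reps_perm_free_preserving reps_perm_move_reps[OF \<pi>i])
    fix x assume x: "x \<in> C"
    then have "\<sigma> x \<in> C" using permutes_in_image[OF \<sigma>(1)] by blast
    then have "rep (\<rho> x) = Hilbert_Choice.inv \<pi> (rep (\<sigma> x))"
      unfolding \<rho>_def using rep_move_reps[OF \<pi>i] by simp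
    also have "rep (\<sigma> x) = \<pi> (rep x)"
      using rep_\<sigma>[OF x EC[OF rep(1)]] rep by (simp add: \<pi>_def)
    finally show "rep (\<rho> x) = rep x" using permutes_inverses(2)[OF \<pi>] by simp
  qed
  then have "generated (move_reps \<pi> \<circ> \<rho>)"
    by (intro generated_comp[OF generated_basic_perm] disjI1 reps_perm_move_reps[OF \<pi>])
  moreover have "move_reps \<pi> \<circ> \<rho> = \<sigma>"
    unfolding \<rho>_def using move_reps_comp[OF \<pi> \<pi>i] permutes_inv_o(1)[OF \<pi>]
    by (auto simp: move_reps_id)
  ultimately show ?thesis by simp
qed

end

section \<open>Permutations preserving independence\<close>

lemma coset_reps_unique:
  assumes n: "n > 0" and E: "coset_reps n E"
  shows "E \<subseteq> {0..<int n}" "\<exists>!e. e \<in> E \<and> [e = x] (mod int (n div rad n))"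
proof -
  have C: "carrier (Z n) = {0..<int n}" using n by (simp add: carrier_integer_mod_group)
  show sub: "E \<subseteq> {0..<int n}" using E by (simp add: coset_reps_def C)
  have dvd: "int (n div rad n) dvd int n"
    using rad_dvd[OF n] by (metis dvd_div_mult_self dvd_triv_left int_dvd_int_iff)
  let ?x = "x mod int n"
  have "?x \<in> carrier (Z n)" using n by (simp add: C)
  then have "Zsub n (rad n) #>\<^bsub>Z n\<^esub> ?x \<in> rcosets\<^bsub>Z n\<^esub> Zsub n (rad n)" by (auto simp: RCOSETS_def)
  then have "\<exists>!e. e \<in> E \<inter> (Zsub n (rad n) #>\<^bsub>Z n\<^esub> ?x)" using E by (simp add: coset_reps_def)
  moreover have "[e = ?x] (mod int (n div rad n)) \<longleftrightarrow> [e = x] (mod int (n div rad n))" for e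
    using dvd by (simp add: cong_def mod_mod_cancel)
  then have "e \<in> E \<inter> (Zsub n (rad n) #>\<^bsub>Z n\<^esub> ?x) \<longleftrightarrow> e \<in> E \<and> [e = x] (mod int (n div rad n))" for e
    using sub by (auto simp: rcoset_Zsub_iff[OF n rad_dvd[OF n]])
  ultimately show "\<exists>!e. e \<in> E \<and> [e = x] (mod int (n div rad n))" by simp
qed

text \<open>For independence, the conclusion \<open>\<epsilon> z \<cdot> z = 0\<close> amounts to \<open>\<epsilon> z = 0\<close> because \<open>\<complex>\<close> is torsion-free.\<close>

lemma independence_as_coefficients:
  assumes "indep \<in> {group_independent, group_quasi_independent}"
  obtains A where "0 \<in> A" "1 \<in> A" "\<And>a. a \<in> A \<Longrightarrow> - a \<in> A"
    "\<And>B::complex set. 0 \<notin> B \<Longrightarrow> indep B \<longleftrightarrow> (\<forall>G \<epsilon>. finite G \<and> G \<subseteq> B \<and> (\<forall>z\<in>G. \<epsilon> z \<in> A) \<and>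
      (\<Sum>z\<in>G. zscale (\<epsilon> z) z) = 0 \<longrightarrow> (\<forall>z\<in>G. \<epsilon> z = 0))"
proof (cases "indep = group_independent")
  case True
  have zero: "(\<forall>z\<in>G. zscale (\<epsilon> z) z = 0) \<longleftrightarrow> (\<forall>z\<in>G. \<epsilon> z = 0)"
    if "0 \<notin> B" "G \<subseteq> B" for B G :: "complex set" and \<epsilon>
    using that by (auto simp: zscale_eq_of_int_mult)
  show ?thesis
  proof (rule that[of UNIV])
    fix B :: "complex set" assume B: "0 \<notin> B"
    have "(finite F \<and> F \<subseteq> B \<and> (\<Sum>z\<in>F. zscale (\<epsilon> z) z) = 0 \<longrightarrow> (\<forall>z\<in>F. zscale (\<epsilon> z) z = 0))
      \<longleftrightarrow> (finite F \<and> F \<subseteq> B \<and> (\<forall>z\<in>F. \<epsilon> z \<in> UNIV) \<and> (\<Sum>z\<in>F. zscale (\<epsilon> z) z) = 0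
        \<longrightarrow> (\<forall>z\<in>F. \<epsilon> z = 0))" for F \<epsilon>
      using zero[OF B, of F \<epsilon>] by auto
    then show "indep B \<longleftrightarrow> (\<forall>G \<epsilon>. finite G \<and> G \<subseteq> B \<and> (\<forall>z\<in>G. \<epsilon> z \<in> UNIV) \<and>
      (\<Sum>z\<in>G. zscale (\<epsilon> z) z) = 0 \<longrightarrow> (\<forall>z\<in>G. \<epsilon> z = 0))"
      unfolding True group_independent_def by (simp only:)
  qed auto
next
  case False
  then have "indep = group_quasi_independent" using assms by simp
  then show ?thesis
    by (intro that[of "{0, 1, -1}"]) (auto simp: group_quasi_independent_def)
qed

theorem theorem3p1p2:
  fixes n :: nat and E :: "int set" and indep :: "complex set \<Rightarrow> bool"
  assumes "n \<ge> 2"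
    and "coset_reps n E"
    and "indep \<in> {group_independent, group_quasi_independent}"
  shows
    "(\<forall>p \<in> prime_factors n. \<forall>\<sigma>. primary_component_perm n p \<sigma>
        \<longrightarrow> preserves n indep (carrier (Z n)) \<sigma>) \<and>
     (2 \<in> prime_factors n \<longrightarrow>
        (\<forall>\<sigma>. Z2_coset_perm n \<sigma> \<longrightarrow> preserves n indep (carrier (Z n)) \<sigma>)) \<and>
     (\<forall>\<sigma>. reps_perm n E \<sigma> \<longrightarrow> preserves n indep (carrier (Z n)) \<sigma>) \<and>
     (\<forall>\<sigma>. \<sigma> permutes Zsub n (rad n) \<longrightarrow>
        (preserves n indep (carrier (Z n)) \<sigma> \<longleftrightarrow> preserves n indep (Zsub n (rad n)) \<sigma>)) \<and>
     (\<forall>\<tau>s. (\<forall>\<tau> \<in> set \<tau>s. \<tau> permutes carrier (Z n) \<and> preserves n indep (carrier (Z n)) \<tau>)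
        \<longrightarrow> preserves n indep (carrier (Z n)) (foldr (\<circ>) \<tau>s id)) \<and>
     (\<forall>\<sigma> \<in> iso (Z n) (Z n). preserves n indep (carrier (Z n)) \<sigma>) \<and>
     (\<forall>t \<in> carrier (Z n). preserves n indep (carrier (Z n)) (\<lambda>x. t \<otimes>\<^bsub>Z n\<^esub> x)) \<and>
     (\<forall>\<sigma>. \<sigma> permutes carrier (Z n) \<and> preserves n indep (carrier (Z n)) \<sigma> \<longrightarrow>
        (\<exists>\<tau>s. (\<forall>\<tau> \<in> set \<tau>s. generating_perm n indep E \<tau>) \<and> \<sigma> = foldr (\<circ>) \<tau>s id))"
proof -
  obtain A where A: "0 \<in> A" "1 \<in> A" "\<And>a. a \<in> A \<Longrightarrow> - a \<in> A"
    and indep: "\<And>B::complex set. 0 \<notin> B \<Longrightarrow> indep B \<longleftrightarrow> (\<forall>G \<epsilon>. finite G \<and> G \<subseteq> B \<and> (\<forall>z\<in>G. \<epsilon> z \<in> A) \<and>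
      (\<Sum>z\<in>G. zscale (\<epsilon> z) z) = 0 \<longrightarrow> (\<forall>z\<in>G. \<epsilon> z = 0))"
    by (rule independence_as_coefficients[OF assms(3)], rule that)
  have n: "n > 0" using assms(1) by simp
  interpret root_of_unity_coset_reps n A E
    by unfold_locales (use assms(1) A coset_reps_unique[OF n assms(2)] in auto)
  let ?S = "Zsub n (rad n)"
  have S: "?S \<subseteq> C" using S_iff by blast
  have free: "free F \<longleftrightarrow> indep (unity_root n ` F)" if "F \<subseteq> C" for F
  proof -
    have "0 \<notin> unity_root n ` F" by auto
    then show ?thesis unfolding free_iff_independent_image[OF that] by (rule indep[symmetric])
  qed
  have pres: "preserves n indep X \<sigma> \<longleftrightarrow> free_preserving X \<sigma>" if X: "X \<subseteq> C" for X \<sigma>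
  proof -
    have "free F = free (\<sigma> ` F) \<longleftrightarrow> indep (unity_root n ` F) = indep (unity_root n ` \<sigma> ` F)"
      if "bij_betw \<sigma> X X" "F \<subseteq> X" for F
    proof -
      have "\<sigma> ` F \<subseteq> X" using that by (auto simp: bij_betw_def)
      then show ?thesis using free[of F] free[of "\<sigma> ` F"] that(2) X by blast
    qed
    then show ?thesis unfolding preserves_def free_preserving_def by blast
  qed
  note presC = pres[OF order_refl] and presS = pres[OF S]
  have g: "generating_perm n indep E \<tau>"
    if "reps_perm n E \<tau> \<or> \<tau> permutes ?S \<and> free_preserving ?S \<tau>" for \<tau>
    using that by (auto simp: generating_perm_def presS)
  show ?thesis
    unfolding C_carrier presC presS
  proof (intro conjI ballI allI impI)
    fix p \<sigma> assume p: "p \<in> prime_factors n" and \<sigma>: "primary_component_perm n p \<sigma>"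
    have "\<sigma> permutes C" using \<sigma> by (simp add: primary_component_perm_def C_carrier)
    then show "free_preserving C \<sigma>"
      using primary_component_perm_respects[OF p \<sigma>]
      by (intro free_preserving_if_respects permutes_imp_bij)
  next
    fix \<sigma> assume "2 \<in> prime_factors n" "Z2_coset_perm n \<sigma>"
    then show "free_preserving C \<sigma>" by (rule Z2_coset_perm_free_preserving)
  next
    fix \<sigma> assume "reps_perm n E \<sigma>"
    then show "free_preserving C \<sigma>" by (rule reps_perm_free_preserving)
  next
    fix \<sigma> assume \<sigma>: "\<sigma> permutes ?S"
    show "free_preserving C \<sigma> \<longleftrightarrow> free_preserving ?S \<sigma>"
    proof
      assume "free_preserving C \<sigma>"
      then show "free_preserving ?S \<sigma>"
        using S permutes_imp_bij[OF \<sigma>] by (auto simp: free_preserving_def)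
    qed (rule free_preserving_extend[OF \<sigma>])
  next
    fix \<tau>s assume "\<forall>\<tau>\<in>set \<tau>s. \<tau> permutes C \<and> free_preserving C \<tau>"
    then show "free_preserving C (foldr (\<circ>) \<tau>s id)" by (intro free_preserving_foldr) blast
  next
    fix \<sigma> assume "\<sigma> \<in> iso (Z n) (Z n)"
    then show "free_preserving C \<sigma>" by (rule automorphism_free_preserving)
  next
    fix t
    show "free_preserving C (\<lambda>x. t \<otimes>\<^bsub>Z n\<^esub> x)"
      unfolding mult_integer_mod_group by (rule translation_free_preserving)
  next
    fix \<sigma> assume "\<sigma> permutes C \<and> free_preserving C \<sigma>"
    then have "generated \<sigma>" using generated_preserving by blast
    then show "\<exists>\<tau>s. (\<forall>\<tau>\<in>set \<tau>s. generating_perm n indep E \<tau>) \<and> \<sigma> = foldr (\<circ>) \<tau>s id"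
      unfolding generated_def using g by blast
  qed
qed

end
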